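(* Let $n\ge4$, let $B\subset\mathbb{R}^n$ be the ball of radius $R$ centered at zero, and let $W(x)=W(|x|)$ be a Bessel potential on $(0,R)$ such that $\frac{W_r(r)}{W(r)}=-\frac{\lambda}{r}+f(r)$, where $f(r)\ge0$ and $\lim_{r\to0}rf(r)=0$. If $\lambda<n-2$, then for all $u\in C_0^\infty(B)$ $$\int_B|\Delta u|^2dx\ge\frac{n^2(n-4)^2}{16}\int_B\frac{u^2}{|x|^4}dx+\Big(\frac{n^2}{4}+\frac{(n-\lambda-2)^2}{4}\Big)\beta(W;R)\int_B\frac{W(x)}{|x|^2}u^2dx .$$
   Context: A non-negative $C^1$ function $W$ on $(0,R)$ is a Bessel potential on $(0,R)$ if there is $c>0$ such that $y''+\frac1r y'+cW(r)y=0$ has a positive solution on $(0,R)$; its weight $\beta(W;R)$ is the supremum of all such $c$. $W_r$ is the derivative in $r$. *)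

theory Defs
  imports "HOL-Analysis.Analysis"
begin

definition positive_solution :: "(real \<Rightarrow> real) \<Rightarrow> real \<Rightarrow> real \<Rightarrow> (real \<Rightarrow> real) \<Rightarrow> bool"
  where "positive_solution W R c y \<longleftrightarrow>
    (\<exists>y' y''. \<forall>r\<in>{0<..<R}.
       0 < y r \<and>
       (y has_real_derivative y' r) (at r) \<and>
       (y' has_real_derivative y'' r) (at r) \<and>
       y'' r + 1 / r * y' r + c * W r * y r = 0)"

definition admissible_constants :: "(real \<Rightarrow> real) \<Rightarrow> real \<Rightarrow> real set"
  where "admissible_constants W R = {c. 0 < c \<and> (\<exists>y. positive_solution W R c y)}"

definition bessel_potential :: "(real \<Rightarrow> real) \<Rightarrow> real \<Rightarrow> bool"
  where "bessel_potential W R \<longleftrightarrow>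
    (\<forall>r\<in>{0<..<R}. 0 \<le> W r) \<and>
    W C1_differentiable_on {0<..<R} \<and>
    admissible_constants W R \<noteq> {}"

text \<open>The weight is an extended non-negative real, so that the supremum is never a junk value:
  it is infinite for the zero potential, for which every constant is admissible.\<close>

definition bessel_weight :: "(real \<Rightarrow> real) \<Rightarrow> real \<Rightarrow> ennreal"
  where "bessel_weight W R = (SUP c\<in>admissible_constants W R. ennreal c)"

definition partial_deriv :: "'a \<Rightarrow> ('a::euclidean_space \<Rightarrow> real) \<Rightarrow> 'a \<Rightarrow> real"
  where "partial_deriv b u x = frechet_derivative u (at x) b"

definition laplacian :: "('a::euclidean_space \<Rightarrow> real) \<Rightarrow> 'a \<Rightarrow> real"
  where "laplacian u x = (\<Sum>b\<in>Basis. partial_deriv b (partial_deriv b u) x)"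

primrec Ck :: "nat \<Rightarrow> ('a::euclidean_space \<Rightarrow> real) \<Rightarrow> bool"
  where
    "Ck 0 u \<longleftrightarrow> continuous_on UNIV u"
  | "Ck (Suc k) u \<longleftrightarrow> u differentiable_on UNIV \<and> (\<forall>b\<in>Basis. Ck k (partial_deriv b u))"

text \<open>Elements of \<open>C\<^sub>0\<^sup>\<infinity>(S)\<close>, for open \<open>S\<close>, are represented by their extensions by zero to the whole
  space, which are again smooth.\<close>

definition test_functions :: "'a::euclidean_space set \<Rightarrow> ('a \<Rightarrow> real) set"
  where "test_functions S =
    {u. (\<forall>k. Ck k u) \<and> compact (closure {x. u x \<noteq> 0}) \<and> closure {x. u x \<noteq> 0} \<subseteq> S}"

end

theory Submission
  imports Defs
begin

text \<open>Let \<open>E = x \<cdot> \<nabla>\<close> be the Euler field and \<open>L\<^sub>a\<^sub>b\<close> the rotation fields, so that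
  \<open>r\<^sup>2 \<Delta> = E\<^sup>2 + (n - 2) E + (1/2) \<Sum> L\<^sub>a\<^sub>b\<^sup>2\<close>; all these fields commute with \<open>E\<close>. This replaces the expansion
  into spherical harmonics. With \<open>w = E u\<close> and the radial part \<open>b = E w + (n - 2) w\<close> one has
  \<open>(r\<^sup>2 \<Delta>u)\<^sup>2 \<ge> b\<^sup>2 + b \<Sum> L\<^sub>a\<^sub>b\<^sup>2 u\<close>, and for \<open>n \<ge> 4\<close> the mixed term has a nonnegative integral against
  \<open>r\<^sup>-\<^sup>4\<close>. It remains to bound \<open>b\<^sup>2\<close>. If \<open>y\<close> solves the equation with constant \<open>c\<close> then \<open>q = r y' / y\<close> satisfies
  \<open>r q' + q\<^sup>2 = - c r\<^sup>2 W\<close> and \<open>q \<le> 0\<close>. Completing squares with the multiplier \<open>p = - (n - 4) / 2 + q\<close> gives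
  \<open>\<integral> r\<^sup>-\<^sup>4 b\<^sup>2 \<ge> \<integral> r\<^sup>-\<^sup>4 (n\<^sup>2/4 + c r\<^sup>2 W) w\<^sup>2\<close> and
  \<open>\<integral> r\<^sup>-\<^sup>4 w\<^sup>2 \<ge> \<integral> r\<^sup>-\<^sup>4 ((n - 4)\<^sup>2/4 + c r\<^sup>2 W) u\<^sup>2\<close>, while the growth condition on \<open>W\<close> gives
  \<open>\<integral> r\<^sup>-\<^sup>2 W w\<^sup>2 \<ge> ((n - \<lambda> - 2) / 2)\<^sup>2 \<integral> r\<^sup>-\<^sup>2 W u\<^sup>2\<close>. Everything is done with a radial cutoff at scale
  \<open>\<epsilon>\<close> near the origin: the error terms involving \<open>u\<^sup>2\<close> have the right sign, those
  involving first derivatives of \<open>u\<close> along these fields are \<open>O(\<epsilon>\<^sup>n\<^sup>-\<^sup>2)\<close>.\<close>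

section \<open>Smooth functions and linear vector fields\<close>

lemma has_derivative_frechet:
  "u differentiable_on UNIV \<Longrightarrow> (u has_derivative frechet_derivative u (at x)) (at x)"
  using frechet_derivative_works[of u "at x"] by (simp add: differentiable_on_def)

lemma partial_deriv_eqI: "(u has_derivative u') (at x) \<Longrightarrow> partial_deriv b u x = u' b"
  using frechet_derivative_at[of u u' x] by (simp add: partial_deriv_def)

lemma frechet_derivative_eq_sum:
  fixes u :: "'a::euclidean_space \<Rightarrow> real"
  assumes "u differentiable_on UNIV"
  shows "frechet_derivative u (at x) z = (\<Sum>b\<in>Basis. (z \<bullet> b) * partial_deriv b u x)"
proof -
  have "linear (frechet_derivative u (at x))"
    using has_derivative_frechet[OF assms] by (rule has_derivative_linear)
  then have "frechet_derivative u (at x) (\<Sum>b\<in>Basis. (z \<bullet> b) *\<^sub>R b) =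
      (\<Sum>b\<in>Basis. (z \<bullet> b) * frechet_derivative u (at x) b)"
    by (simp add: linear_sum linear_cmul)
  then show ?thesis by (simp add: euclidean_representation partial_deriv_def)
qed

text \<open>The base case is the continuity of differentiable functions. Closure under products
  needs this descent, since the partial derivatives of a product still contain undifferentiated
  factors.\<close>

lemma Ck_SucD: "Ck (Suc k) u \<Longrightarrow> Ck k u"
proof (induction k arbitrary: u)
  case 0
  then show ?case by (simp add: differentiable_imp_continuous_on)
next
  case (Suc k)
  have "u differentiable_on UNIV" using Suc.prems by simp
  moreover have "Ck k (partial_deriv b u)" if "b \<in> Basis" for b
    using Suc.prems that by (intro Suc.IH) (simp del: Ck.simps(1))
  ultimately show ?case by simp
qed

lemma Ck_const: "Ck k (\<lambda>x. c)"
proof (induction k arbitrary: c)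
  case (Suc k)
  have "partial_deriv b (\<lambda>x. c) = (\<lambda>x. 0)" for b :: 'a
    by (rule ext, rule partial_deriv_eqI) simp
  with Suc show ?case by simp
qed simp

lemma Ck_inner: "Ck k (\<lambda>x. x \<bullet> w)"
proof (cases k)
  case (Suc k)
  have "partial_deriv b (\<lambda>x. x \<bullet> w) = (\<lambda>x. b \<bullet> w)" for b
    by (rule ext, rule partial_deriv_eqI[where u' = "\<lambda>h. h \<bullet> w" for w]) (auto intro!: derivative_eq_intros)
  moreover have "(\<lambda>x. x \<bullet> w) differentiable_on UNIV"
    by (intro bounded_linear_imp_differentiable_on bounded_linear_inner_left)
  ultimately show ?thesis by (simp add: Suc Ck_const)
qed (auto intro: continuous_intros)

lemma Ck_add: "Ck k f \<Longrightarrow> Ck k g \<Longrightarrow> Ck k (\<lambda>x. f x + g x)"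
proof (induction k arbitrary: f g)
  case (Suc k)
  then have d: "f differentiable_on UNIV" "g differentiable_on UNIV" by auto
  have "partial_deriv b (\<lambda>x. f x + g x) = (\<lambda>x. partial_deriv b f x + partial_deriv b g x)" for b
    unfolding partial_deriv_def[of b f] partial_deriv_def[of b g]
    by (rule ext, rule partial_deriv_eqI) (intro derivative_intros has_derivative_frechet d)
  with Suc d show ?case by simp
qed (auto intro: continuous_intros)

lemma Ck_mult: "Ck k f \<Longrightarrow> Ck k g \<Longrightarrow> Ck k (\<lambda>x. f x * g x)"
proof (induction k arbitrary: f g)
  case (Suc k)
  then have d: "f differentiable_on UNIV" "g differentiable_on UNIV" by auto
  have "partial_deriv b (\<lambda>x. f x * g x) =
      (\<lambda>x. f x * partial_deriv b g x + partial_deriv b f x * g x)" for b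
    unfolding partial_deriv_def[of b f] partial_deriv_def[of b g]
    by (rule ext, rule partial_deriv_eqI) (intro derivative_intros has_derivative_frechet d)
  moreover have "Ck k f" "Ck k g" using Suc.prems by (auto intro: Ck_SucD)
  ultimately show ?case using Suc d by (auto intro!: Ck_add Suc.IH)
qed (auto intro: continuous_intros)

definition smooth :: "('a::euclidean_space \<Rightarrow> real) \<Rightarrow> bool"
  where "smooth u \<longleftrightarrow> (\<forall>k. Ck k u)"

lemma smooth_const: "smooth (\<lambda>x. c)"
  and smooth_inner: "smooth (\<lambda>x. x \<bullet> w)"
  and smooth_add: "smooth f \<Longrightarrow> smooth g \<Longrightarrow> smooth (\<lambda>x. f x + g x)"
  and smooth_mult: "smooth f \<Longrightarrow> smooth g \<Longrightarrow> smooth (\<lambda>x. f x * g x)"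
  by (simp_all add: smooth_def Ck_const Ck_inner Ck_add Ck_mult)

lemma smooth_sum: "(\<And>i. i \<in> I \<Longrightarrow> smooth (f i)) \<Longrightarrow> smooth (\<lambda>x. \<Sum>i\<in>I. f i x)"
  by (induction I rule: infinite_finite_induct) (auto intro: smooth_const smooth_add)

lemma smooth_partial_deriv: "smooth u \<Longrightarrow> b \<in> Basis \<Longrightarrow> smooth (partial_deriv b u)"
  unfolding smooth_def by (metis Ck.simps(2))

lemma smooth_differentiable: "smooth u \<Longrightarrow> u differentiable_on UNIV"
  unfolding smooth_def by (metis Ck.simps(2))

lemma smooth_continuous: "smooth u \<Longrightarrow> continuous_on S u"
  unfolding smooth_def by (metis Ck.simps(1) continuous_on_subset subset_UNIV)

lemmas smooth_has_derivative = has_derivative_frechet[OF smooth_differentiable]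

section \<open>Symmetry of second partial derivatives\<close>

lemma partial_deriv_line:
  assumes "smooth u"
  shows "((\<lambda>t. u (z + t *\<^sub>R a)) has_real_derivative partial_deriv a u (z + t *\<^sub>R a)) (at t)"
proof -
  have "((\<lambda>t. u (z + t *\<^sub>R a)) has_derivative
      (\<lambda>s. frechet_derivative u (at (z + t *\<^sub>R a)) (s *\<^sub>R a))) (at t)"
    using smooth_has_derivative[OF assms]
    by (rule has_derivative_compose[rotated]) (auto intro!: derivative_eq_intros)
  moreover have "linear (frechet_derivative u (at (z + t *\<^sub>R a)))"
    using smooth_has_derivative[OF assms] by (rule has_derivative_linear)
  ultimately show ?thesis
    by (simp add: has_field_derivative_def partial_deriv_def linear_cmul mult_commute_abs)
qed

text \<open>The mean value theorem is applied along \<open>a\<close> to the increment of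
  \<open>u\<close> in direction \<open>b\<close>, and then along \<open>b\<close> to the
  \<open>a\<close>-derivative. The second difference becomes a mixed derivative at a point that
  approaches \<open>x\<close> as \<open>s\<close> shrinks.\<close>

lemma second_difference_mvt:
  assumes u: "smooth u" and a: "a \<in> Basis" and s: "0 < s"
  obtains \<xi> \<zeta> where "0 < \<xi>" "\<xi> < s" "0 < \<zeta>" "\<zeta> < s"
    "u (x + s *\<^sub>R a + s *\<^sub>R b) - u (x + s *\<^sub>R a) - u (x + s *\<^sub>R b) + u x =
      s\<^sup>2 * partial_deriv b (partial_deriv a u) (x + \<xi> *\<^sub>R a + \<zeta> *\<^sub>R b)"
proof -
  let ?g = "\<lambda>t. u ((x + s *\<^sub>R b) + t *\<^sub>R a) - u (x + t *\<^sub>R a)"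
  have "\<And>t. (?g has_real_derivative
      partial_deriv a u ((x + s *\<^sub>R b) + t *\<^sub>R a) - partial_deriv a u (x + t *\<^sub>R a)) (at t)"
    by (intro derivative_intros partial_deriv_line u)
  from MVT2[OF s this] obtain \<xi> where \<xi>: "0 < \<xi>" "\<xi> < s"
    and 1: "?g s - ?g 0 = s * (partial_deriv a u ((x + s *\<^sub>R b) + \<xi> *\<^sub>R a) - partial_deriv a u (x + \<xi> *\<^sub>R a))"
    by auto
  have "\<And>t. ((\<lambda>t. partial_deriv a u ((x + \<xi> *\<^sub>R a) + t *\<^sub>R b)) has_real_derivative
      partial_deriv b (partial_deriv a u) ((x + \<xi> *\<^sub>R a) + t *\<^sub>R b)) (at t)"
    by (intro partial_deriv_line smooth_partial_deriv u a)
  from MVT2[OF s this] obtain \<zeta> where \<zeta>: "0 < \<zeta>" "\<zeta> < s"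
    and 2: "partial_deriv a u ((x + \<xi> *\<^sub>R a) + s *\<^sub>R b) - partial_deriv a u (x + \<xi> *\<^sub>R a) =
      s * partial_deriv b (partial_deriv a u) (x + \<xi> *\<^sub>R a + \<zeta> *\<^sub>R b)"
    by auto
  have "?g s - ?g 0 = s\<^sup>2 * partial_deriv b (partial_deriv a u) (x + \<xi> *\<^sub>R a + \<zeta> *\<^sub>R b)"
    using 1 2 by (simp add: power2_eq_square add_ac)
  then show thesis
    by (intro that[OF \<xi> \<zeta>]) (simp add: algebra_simps)
qed

text \<open>The second difference is symmetric in the two directions, so a value of one mixed
  derivative near \<open>x\<close> equals a value of the other near \<open>x\<close>. Continuity
  excludes a gap at \<open>x\<close> itself.\<close>

lemma partial_deriv_commute:
  assumes u: "smooth u" and a: "a \<in> Basis" and b: "b \<in> Basis"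
  shows "partial_deriv a (partial_deriv b u) x = partial_deriv b (partial_deriv a u) x" (is "?f x = ?g x")
proof (rule ccontr)
  \<comment> \<open>Half the gap: a number within \<open>e\<close> of \<open>?f x\<close> cannot
    equal a number within \<open>e\<close> of \<open>?g x\<close>.\<close>
  define e where "e = \<bar>?f x - ?g x\<bar> / 2"
  assume "?f x \<noteq> ?g x"
  then have e: "e > 0" by (simp add: e_def)
  have "isCont ?f x" "isCont ?g x"
    using smooth_continuous[of ?f UNIV] smooth_continuous[of ?g UNIV]
    by (auto simp: continuous_on_eq_continuous_at smooth_partial_deriv u a b)
  then have "\<exists>d>0. \<forall>z. dist z x < d \<longrightarrow> dist (?f z) (?f x) < e"
    "\<exists>d>0. \<forall>z. dist z x < d \<longrightarrow> dist (?g z) (?g x) < e"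
    unfolding continuous_at_eps_delta using e by simp_all
  then obtain d1 d2 where d: "d1 > 0" "\<And>z. dist z x < d1 \<Longrightarrow> dist (?f z) (?f x) < e"
    "d2 > 0" "\<And>z. dist z x < d2 \<Longrightarrow> dist (?g z) (?g x) < e"
    by blast
  \<comment> \<open>Both displacements stay below \<open>s\<close>, so the intermediate points lie
    within \<open>2 * s\<close> of \<open>x\<close>.\<close>
  define s where "s = min d1 d2 / 2"
  have s: "s > 0" using d by (simp add: s_def)
  have near: "dist (x + \<xi> *\<^sub>R a + \<zeta> *\<^sub>R b) x < min d1 d2"
    if "0 < \<xi>" "\<xi> < s" "0 < \<zeta>" "\<zeta> < s" and a: "a \<in> Basis" and b: "b \<in> Basis" for a b \<xi> \<zeta>
  proof -
    have "dist (x + \<xi> *\<^sub>R a + \<zeta> *\<^sub>R b) x = norm (\<xi> *\<^sub>R a + \<zeta> *\<^sub>R b)"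
      by (simp add: dist_norm add.assoc)
    also have "\<dots> \<le> \<xi> + \<zeta>"
      using norm_triangle_ineq[of "\<xi> *\<^sub>R a" "\<zeta> *\<^sub>R b"] that by (simp add: norm_Basis)
    finally show ?thesis using that by (simp add: s_def)
  qed
  obtain \<xi> \<zeta> where 1: "0 < \<xi>" "\<xi> < s" "0 < \<zeta>" "\<zeta> < s"
    "u (x + s *\<^sub>R a + s *\<^sub>R b) - u (x + s *\<^sub>R a) - u (x + s *\<^sub>R b) + u x =
      s\<^sup>2 * ?g (x + \<xi> *\<^sub>R a + \<zeta> *\<^sub>R b)"
    using second_difference_mvt[OF u a s] by blast
  obtain \<xi>' \<zeta>' where 2: "0 < \<xi>'" "\<xi>' < s" "0 < \<zeta>'" "\<zeta>' < s"
    "u (x + s *\<^sub>R b + s *\<^sub>R a) - u (x + s *\<^sub>R b) - u (x + s *\<^sub>R a) + u x =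
      s\<^sup>2 * ?f (x + \<xi>' *\<^sub>R b + \<zeta>' *\<^sub>R a)"
    using second_difference_mvt[OF u b s] by blast
  have "x + s *\<^sub>R b + s *\<^sub>R a = x + s *\<^sub>R a + s *\<^sub>R b" by simp
  then have "s\<^sup>2 * ?g (x + \<xi> *\<^sub>R a + \<zeta> *\<^sub>R b) = s\<^sup>2 * ?f (x + \<xi>' *\<^sub>R b + \<zeta>' *\<^sub>R a)"
    using 1(5) 2(5) by (simp only:)
  then have "?g (x + \<xi> *\<^sub>R a + \<zeta> *\<^sub>R b) = ?f (x + \<xi>' *\<^sub>R b + \<zeta>' *\<^sub>R a)"
    using s by simp
  then show False
    using d(4)[of "x + \<xi> *\<^sub>R a + \<zeta> *\<^sub>R b"] d(2)[of "x + \<xi>' *\<^sub>R b + \<zeta>' *\<^sub>R a"]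
      near[OF 1(1-4) a b] near[OF 2(1-4) b a]
    by (auto simp: e_def dist_real_def abs_if split: if_splits)
qed

section \<open>Derivatives along vector fields and the Hessian form\<close>

definition field_deriv :: "('a::euclidean_space \<Rightarrow> 'a) \<Rightarrow> ('a \<Rightarrow> real) \<Rightarrow> 'a \<Rightarrow> real"
  where "field_deriv A u x = frechet_derivative u (at x) (A x)"

definition hess :: "('a::euclidean_space \<Rightarrow> real) \<Rightarrow> 'a \<Rightarrow> 'a \<Rightarrow> 'a \<Rightarrow> real"
  where "hess u x v w = (\<Sum>a\<in>Basis. \<Sum>b\<in>Basis. (v \<bullet> a) * (w \<bullet> b) * partial_deriv a (partial_deriv b u) x)"

lemma hess_commute:
  assumes "smooth u" shows "hess u x v w = hess u x w v"
proof -
  have "hess u x w v =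
      (\<Sum>b\<in>Basis. \<Sum>a\<in>Basis. (w \<bullet> a) * (v \<bullet> b) * partial_deriv a (partial_deriv b u) x)"
    unfolding hess_def by (rule sum.swap)
  also have "\<dots> = hess u x v w"
    unfolding hess_def
    by (intro sum.cong refl) (simp add: partial_deriv_commute[OF assms] mult_ac)
  finally show ?thesis ..
qed

lemma field_deriv_eq_sum:
  assumes "smooth u"
  shows "field_deriv A u x = (\<Sum>b\<in>Basis. (A x \<bullet> b) * partial_deriv b u x)"
  by (simp add: field_deriv_def frechet_derivative_eq_sum smooth_differentiable assms)

lemma field_deriv_mult:
  assumes "smooth f" "smooth g"
  shows "field_deriv A (\<lambda>x. f x * g x) x = f x * field_deriv A g x + field_deriv A f x * g x"
  unfolding field_deriv_def
  by (subst frechet_derivative_at[symmetric])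
    (auto intro!: has_derivative_mult smooth_has_derivative assms)

lemma field_deriv_add:
  assumes "smooth f" "smooth g"
  shows "field_deriv A (\<lambda>x. f x + g x) x = field_deriv A f x + field_deriv A g x"
  unfolding field_deriv_def
  by (subst frechet_derivative_at[symmetric])
    (auto intro!: has_derivative_add smooth_has_derivative assms)

lemma field_deriv_cmult:
  assumes "smooth f"
  shows "field_deriv A (\<lambda>x. c * f x) x = c * field_deriv A f x"
  unfolding field_deriv_def
  by (subst frechet_derivative_at[symmetric])
    (auto intro!: has_derivative_mult_right smooth_has_derivative assms)

lemma linear_inner_adjoint:
  fixes A :: "'a::euclidean_space \<Rightarrow> 'a"
  assumes "linear A" shows "A x \<bullet> b = x \<bullet> adjoint A b"
  using adjoint_works[OF assms, of x b] by (simp add: inner_commute)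

text \<open>The coefficients of a linear field are inner products of \<open>x\<close> with fixed
  vectors, obtained from the adjoint, and hence smooth.\<close>

lemma smooth_field_deriv:
  assumes "linear A" "smooth u" shows "smooth (field_deriv A u)"
proof -
  have "field_deriv A u = (\<lambda>x. \<Sum>b\<in>Basis. (x \<bullet> adjoint A b) * partial_deriv b u x)"
    by (rule ext) (simp add: field_deriv_eq_sum linear_inner_adjoint assms)
  then show ?thesis
    by (auto intro!: smooth_sum smooth_mult smooth_inner smooth_partial_deriv assms)
qed

text \<open>Product rule: a linear coefficient field is its own derivative, which gives the
  first-order term, and the rest is the Hessian. As the Hessian is symmetric, two such derivatives
  commute as soon as the linear maps do.\<close>

lemma field_deriv_field_deriv:
  assumes A: "linear A" and u: "smooth u"
  shows "field_deriv B (field_deriv A u) x = frechet_derivative u (at x) (A (B x)) + hess u x (B x) (A x)"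
proof -
  have eq: "field_deriv A u = (\<lambda>x. \<Sum>b\<in>Basis. (A x \<bullet> b) * partial_deriv b u x)"
    by (rule ext) (simp add: field_deriv_eq_sum u)
  have "(field_deriv A u has_derivative
      (\<lambda>z. \<Sum>b\<in>Basis. (A x \<bullet> b) * frechet_derivative (partial_deriv b u) (at x) z
        + (A z \<bullet> b) * partial_deriv b u x)) (at x)"
    unfolding eq
    by (intro has_derivative_sum has_derivative_mult smooth_has_derivative smooth_partial_deriv u
        has_derivative_inner_left linear_imp_has_derivative[OF A])
  then have "field_deriv B (field_deriv A u) x =
      (\<Sum>b\<in>Basis. (A x \<bullet> b) * frechet_derivative (partial_deriv b u) (at x) (B x)
        + (A (B x) \<bullet> b) * partial_deriv b u x)"
    unfolding field_deriv_def[of B] by (subst frechet_derivative_at[symmetric]) auto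
  also have "\<dots> = (\<Sum>b\<in>Basis. (A (B x) \<bullet> b) * partial_deriv b u x)
      + (\<Sum>b\<in>Basis. \<Sum>a\<in>Basis. (B x \<bullet> a) * (A x \<bullet> b) * partial_deriv a (partial_deriv b u) x)"
    by (simp add: frechet_derivative_eq_sum smooth_differentiable smooth_partial_deriv u
        sum.distrib sum_distrib_left mult_ac)
  also have "(\<Sum>b\<in>Basis. \<Sum>a\<in>Basis. (B x \<bullet> a) * (A x \<bullet> b) * partial_deriv a (partial_deriv b u) x)
      = hess u x (B x) (A x)"
    unfolding hess_def by (rule sum.swap)
  finally show ?thesis
    by (simp add: frechet_derivative_eq_sum smooth_differentiable u)
qed

section \<open>Rotation fields and the Laplacian in terms of the Euler field\<close>

definition rot :: "'a::euclidean_space \<Rightarrow> 'a \<Rightarrow> 'a \<Rightarrow> 'a"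
  where "rot a b x = (x \<bullet> a) *\<^sub>R b - (x \<bullet> b) *\<^sub>R a"

abbreviation euler :: "('a::euclidean_space \<Rightarrow> real) \<Rightarrow> 'a \<Rightarrow> real"
  where "euler \<equiv> field_deriv (\<lambda>x. x)"

lemma linear_rot: "linear (rot a b)"
  by (rule linearI) (simp_all add: rot_def algebra_simps)

text \<open>For orthonormal \<open>a\<close> and \<open>b\<close>, \<open>rot a b\<close> generates
  the rotations of their plane. Its tangency to spheres makes it annihilate radial weights; together
  with the vanishing trace this removes every boundary and cutoff term from integration by
  parts.\<close>

lemma inner_rot_self: "x \<bullet> rot a b x = 0"
  by (simp add: rot_def inner_diff_right mult.commute)

lemma trace_rot: "(\<Sum>c\<in>Basis. rot a b c \<bullet> c) = 0"
proof (intro sum.neutral ballI)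
  fix c
  show "rot a b c \<bullet> c = 0"
    by (simp add: rot_def inner_diff_left inner_commute[of c] mult.commute)
qed

text \<open>The identity commutes with every linear map, so the first-order parts of the two
  iterated derivatives agree, and the Hessian is symmetric.\<close>

lemma euler_rot_commute:
  assumes "smooth u"
  shows "euler (field_deriv (rot a b) u) = field_deriv (rot a b) (euler u)"
proof
  fix x
  show "euler (field_deriv (rot a b) u) x = field_deriv (rot a b) (euler u) x"
    using hess_commute[OF assms, of x x "rot a b x"]
    by (simp add: field_deriv_field_deriv[OF linear_rot assms] field_deriv_field_deriv[OF linear_ident assms])
qed

lemma hess_Basis:
  assumes "a \<in> Basis" "b \<in> Basis"
  shows "hess u x a b = partial_deriv a (partial_deriv b u) x"
proof -
  have "hess u x a b = (\<Sum>c\<in>Basis. (a \<bullet> c) * (\<Sum>d\<in>Basis. (b \<bullet> d) * partial_deriv c (partial_deriv d u) x))"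
    by (simp add: hess_def sum_distrib_left mult.assoc)
  also have "\<dots> = partial_deriv a (partial_deriv b u) x"
    using assms by (simp add: inner_Basis if_distrib[of "\<lambda>c. c * _"] cong: if_cong)
  finally show ?thesis .
qed

lemma hess_diff_left: "hess u x (v - v') w = hess u x v w - hess u x v' w"
  and hess_diff_right: "hess u x w (v - v') = hess u x w v - hess u x w v'"
  and hess_scale_left: "hess u x (c *\<^sub>R v) w = c * hess u x v w"
  and hess_scale_right: "hess u x w (c *\<^sub>R v) = c * hess u x w v"
  by (simp_all add: hess_def inner_diff_left left_diff_distrib right_diff_distrib sum_subtractf
      sum_distrib_left mult_ac)

text \<open>Summing over ordered pairs counts each coordinate plane twice, hence the division by 2.
  The rotations contribute \<open>(norm x)\<^sup>2 * laplacian u x\<close> minus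
  \<open>hess u x x x\<close> and minus \<open>DIM('a) - 1\<close> times the Euler derivative;
  \<open>euler (euler u)\<close> restores the Hessian term and one Euler derivative.\<close>

lemma laplacian_euler_rot:
  fixes u :: "'a::euclidean_space \<Rightarrow> real"
  assumes u: "smooth u"
  shows "(norm x)\<^sup>2 * laplacian u x =
    euler (euler u) x + (real DIM('a) - 2) * euler u x
      + (\<Sum>a\<in>Basis. \<Sum>b\<in>Basis. field_deriv (rot a b) (field_deriv (rot a b) u) x) / 2"
proof -
  define D where "D = frechet_derivative u (at x)"
  define T where "T = D x"
  define H where "H a b = partial_deriv a (partial_deriv b u) x" for a b
  have lin: "linear D"
    unfolding D_def using smooth_has_derivative[OF u] by (rule has_derivative_linear)
  have T: "(\<Sum>b\<in>Basis. (x \<bullet> b) * D b) = T"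
    by (simp add: T_def D_def frechet_derivative_eq_sum smooth_differentiable u partial_deriv_def)
  have HH: "(\<Sum>a\<in>Basis. \<Sum>b\<in>Basis. (x \<bullet> a) * (x \<bullet> b) * H a b) = hess u x x x"
    by (simp add: hess_def H_def)
  have r: "(\<Sum>a\<in>Basis. (x \<bullet> a)\<^sup>2) = (norm x)\<^sup>2"
    unfolding power2_norm_eq_inner by (subst euclidean_inner) (simp add: power2_eq_square)
  \<comment> \<open>The diagonal is isolated in conditionals and the remaining products are kept
    apart, so that the double sum can be evaluated term by term through \<open>s1\<close> to
    \<open>s6\<close>.\<close>
  have one: "field_deriv (rot a b) (field_deriv (rot a b) u) x =
      (((if a = b then (x \<bullet> a) * D a else 0) + (if a = b then (x \<bullet> a) * D a else 0))
        - ((x \<bullet> b) * D b + (x \<bullet> a) * D a))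
      + (((x \<bullet> a)\<^sup>2 * H b b + (x \<bullet> b)\<^sup>2 * H a a)
        - ((x \<bullet> a) * (x \<bullet> b) * H a b + (x \<bullet> b) * (x \<bullet> a) * H b a))"
    if ab: "a \<in> Basis" "b \<in> Basis" for a b
  proof -
    have "rot a b (rot a b x) = ((x \<bullet> a) * (b \<bullet> a) - (x \<bullet> b)) *\<^sub>R b - ((x \<bullet> a) - (x \<bullet> b) * (a \<bullet> b)) *\<^sub>R a"
      using ab by (simp add: rot_def inner_diff_left)
    then have "D (rot a b (rot a b x)) =
        ((x \<bullet> a) * (b \<bullet> a) - (x \<bullet> b)) * D b - ((x \<bullet> a) - (x \<bullet> b) * (a \<bullet> b)) * D a"
      by (simp only: linear_diff[OF lin] linear_cmul[OF lin] real_scaleR_def)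
    then have "D (rot a b (rot a b x)) =
        ((if a = b then (x \<bullet> a) * D a else 0) + (if a = b then (x \<bullet> a) * D a else 0))
        - ((x \<bullet> b) * D b + (x \<bullet> a) * D a)"
      using ab by (simp add: inner_Basis algebra_simps)
    moreover have "hess u x (rot a b x) (rot a b x) = ((x \<bullet> a)\<^sup>2 * H b b + (x \<bullet> b)\<^sup>2 * H a a)
        - ((x \<bullet> a) * (x \<bullet> b) * H a b + (x \<bullet> b) * (x \<bullet> a) * H b a)"
      using ab by (simp add: rot_def hess_diff_left hess_diff_right hess_scale_left hess_scale_right
          hess_Basis H_def algebra_simps power2_eq_square)
    ultimately show ?thesis
      by (simp add: field_deriv_field_deriv[OF linear_rot u] D_def)
  qed
  have L: "laplacian u x = (\<Sum>a\<in>Basis. H a a)" by (simp add: laplacian_def H_def)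
  have s1: "(\<Sum>a\<in>Basis. \<Sum>b\<in>Basis. if a = b then (x \<bullet> a) * D a else 0) = T"
    by (simp add: T)
  have s2: "(\<Sum>a\<in>(Basis::'a set). \<Sum>b\<in>Basis. (x \<bullet> b) * D b) = real DIM('a) * T"
    by (simp add: T)
  have s3: "(\<Sum>a\<in>Basis. \<Sum>b\<in>(Basis::'a set). (x \<bullet> a) * D a) = real DIM('a) * T"
    by (simp add: sum_distrib_left[symmetric] T)
  have s4: "(\<Sum>a\<in>Basis. \<Sum>b\<in>Basis. (x \<bullet> a)\<^sup>2 * H b b) = (norm x)\<^sup>2 * laplacian u x"
    by (simp add: L r[symmetric] sum_product)
  have s5: "(\<Sum>a\<in>Basis. \<Sum>b\<in>Basis. (x \<bullet> b)\<^sup>2 * H a a) = (norm x)\<^sup>2 * laplacian u x"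
    using s4 by (subst sum.swap)
  have s6: "(\<Sum>a\<in>Basis. \<Sum>b\<in>Basis. (x \<bullet> b) * (x \<bullet> a) * H b a) = hess u x x x"
    using HH by (subst sum.swap)
  have "(\<Sum>a\<in>Basis. \<Sum>b\<in>Basis. field_deriv (rot a b) (field_deriv (rot a b) u) x) =
      ((T + T) - (real DIM('a) * T + real DIM('a) * T))
      + (((norm x)\<^sup>2 * laplacian u x + (norm x)\<^sup>2 * laplacian u x) - (hess u x x x + hess u x x x))"
    by (simp only: one sum.distrib sum_subtractf s1 s2 s3 s4 s5 s6 HH cong: sum.cong)
  moreover have "euler (euler u) x = T + hess u x x x"
    using field_deriv_field_deriv[OF linear_ident u, of "\<lambda>x. x" x] by (simp add: T_def D_def)
  moreover have "euler u x = T"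
    by (simp add: T_def D_def field_deriv_def)
  ultimately show ?thesis by (simp add: field_simps)
qed

section \<open>Integration by parts along linear vector fields\<close>

lemma integrable_compact_support:
  fixes f :: "'a::euclidean_space \<Rightarrow> real"
  assumes "compact K" "continuous_on K f" "\<And>x. x \<notin> K \<Longrightarrow> f x = 0"
  shows "integrable lborel f"
proof -
  have "integrable lborel (\<lambda>x. indicator K x *\<^sub>R f x)"
    using assms(1,2) by (rule borel_integrable_compact)
  moreover have "(\<lambda>x. indicator K x *\<^sub>R f x) = f"
    using assms(3) by (auto simp: fun_eq_iff split: split_indicator)
  ultimately show ?thesis by simp
qed

lemma integral_lborel_translate:
  fixes f :: "'a::euclidean_space \<Rightarrow> real"
  assumes "f \<in> borel_measurable borel"
  shows "(\<integral>x. f (c + x) \<partial>lborel) = (\<integral>x. f x \<partial>lborel)"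
proof -
  have "(\<integral>x. f x \<partial>lborel) = (\<integral>x. f x \<partial>(distr lborel borel ((+) c)))"
    by (simp add: lborel_distr_plus)
  also have "\<dots> = (\<integral>x. f (c + x) \<partial>lborel)"
    using assms by (subst integral_distr) auto
  finally show ?thesis ..
qed

text \<open>The derivative is a dominated limit of difference quotients, and each quotient has
  integral zero because Lebesgue measure is translation invariant.\<close>

lemma integral_directional_derivative:
  fixes h h' :: "'a::euclidean_space \<Rightarrow> real"
  assumes K: "compact K" and h0: "\<And>x. x \<notin> K \<Longrightarrow> h x = 0" and h'0: "\<And>x. x \<notin> K \<Longrightarrow> h' x = 0"
    and hc: "continuous_on UNIV h" and h'c: "continuous_on UNIV h'"
    and d: "\<And>x. ((\<lambda>t. h (x + t *\<^sub>R b)) has_real_derivative h' x) (at 0)"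
  shows "(\<integral>x. h' x \<partial>lborel) = 0"
proof -
  have hI: "integrable lborel h"
    using K continuous_on_subset[OF hc] h0 by (rule integrable_compact_support) auto
  have hb: "h \<in> borel_measurable borel" "h' \<in> borel_measurable borel"
    using hc h'c by (auto intro: borel_measurable_continuous_onI)
  have "bounded (h' ` K)"
    using K continuous_on_subset[OF h'c] by (intro compact_imp_bounded compact_continuous_image) auto
  then obtain B where "\<And>x. x \<in> K \<Longrightarrow> norm (h' x) \<le> B" by (auto simp: bounded_iff)
  then have B: "\<bar>h' x\<bar> \<le> max B 0" for x
    using h'0[of x] by (cases "x \<in> K") (auto simp: le_max_iff_disj)
  obtain \<rho> where \<rho>: "\<And>x. x \<in> K \<Longrightarrow> norm x \<le> \<rho>"
    using compact_imp_bounded[OF K] by (auto simp: bounded_iff)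
  \<comment> \<open>As the steps \<open>t i\<close> are at most 1, all difference quotients vanish
    off this ball, which gives one integrable majorant for every \<open>i\<close>.\<close>
  define C where "C = cball (0::'a) (\<rho> + norm b)"
  define t where "t i = 1 / real (Suc i)" for i
  have t: "0 < t i" "t i \<le> 1" for i by (auto simp: t_def)
  define s where "s i x = (h (x + t i *\<^sub>R b) - h x) / t i" for i x
  \<comment> \<open>The assumption \<open>d\<close> concerns parameter 0 but arbitrary base points;
    moving the base point gives the derivative along the whole line.\<close>
  have dl: "((\<lambda>t. h (x + t *\<^sub>R b)) has_real_derivative h' (x + r *\<^sub>R b)) (at r)" for x r
  proof -
    have "((\<lambda>t. h ((x + r *\<^sub>R b) + t *\<^sub>R b)) has_real_derivative h' (x + r *\<^sub>R b)) (at 0)"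
      by (rule d)
    then have "((\<lambda>t. h (x + (t + r) *\<^sub>R b)) has_real_derivative h' (x + r *\<^sub>R b)) (at 0)"
      by (simp add: algebra_simps)
    then show ?thesis using DERIV_at_within_shift[of "\<lambda>t. h (x + t *\<^sub>R b)" _ r 0 UNIV] by (simp add: add.commute)
  qed
  have "(\<lambda>i. integral\<^sup>L lborel (s i)) \<longlonglongrightarrow> integral\<^sup>L lborel h'"
  proof (rule integral_dominated_convergence)
    show "h' \<in> borel_measurable lborel" using hb by simp
    show "s i \<in> borel_measurable lborel" for i
      unfolding s_def using hb by measurable
    show "integrable lborel (\<lambda>x. indicator C x *\<^sub>R max B 0)"
      by (intro borel_integrable_compact) (auto simp: C_def)
    show "AE x in lborel. (\<lambda>i. s i x) \<longlonglongrightarrow> h' x"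
    proof (intro always_eventually allI)
      fix x
      have "((\<lambda>r. (h (x + r *\<^sub>R b) - h x) / r) \<longlongrightarrow> h' x) (at 0)"
        using d[of x] by (simp add: has_field_derivative_iff)
      moreover have "t \<longlonglongrightarrow> 0" unfolding t_def by (rule lim_1_over_n[THEN LIMSEQ_Suc])
      then have "filterlim t (at 0) sequentially"
        using t(1) by (auto simp: filterlim_at less_imp_neq[symmetric])
      ultimately show "(\<lambda>i. s i x) \<longlonglongrightarrow> h' x"
        unfolding s_def by (rule filterlim_compose)
    qed
    show "AE x in lborel. norm (s i x) \<le> indicator C x *\<^sub>R max B 0" for i
    proof (intro always_eventually allI)
      fix x
      show "norm (s i x) \<le> indicator C x *\<^sub>R max B 0"
      proof (cases "x \<in> C")
        case True
        \<comment> \<open>By the mean value theorem a difference quotient is a value of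
          \<open>h'\<close>, so the bound on \<open>h'\<close> dominates it.\<close>
        have "\<exists>z>0. z < t i \<and> h (x + t i *\<^sub>R b) - h (x + 0 *\<^sub>R b) = (t i - 0) * h' (x + z *\<^sub>R b)"
          using t by (intro MVT2 dl) auto
        then obtain z where "h (x + t i *\<^sub>R b) - h x = t i * h' (x + z *\<^sub>R b)" by auto
        then have "s i x = h' (x + z *\<^sub>R b)" using t[of i] by (simp add: s_def)
        then show ?thesis using True B by simp
      next
        case False
        then have x: "\<rho> + norm b < norm x" by (simp add: C_def)
        have "norm (t i *\<^sub>R b) \<le> norm b" using t[of i] by (simp add: mult_left_le_one_le)
        moreover have "norm x \<le> norm (x + t i *\<^sub>R b) + norm (t i *\<^sub>R b)"
          using norm_triangle_ineq[of "x + t i *\<^sub>R b" "- (t i *\<^sub>R b)"] by simp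
        ultimately have "\<rho> < norm (x + t i *\<^sub>R b)" "\<rho> < norm x" using x norm_ge_zero[of b] by linarith+
        then have "h (x + t i *\<^sub>R b) = 0" "h x = 0" using \<rho> h0 by (meson not_le)+
        then show ?thesis using False by (simp add: s_def)
      qed
    qed
  qed
  moreover have "integral\<^sup>L lborel (s i) = 0" for i
  proof -
    have "integrable lborel (\<lambda>x. h (t i *\<^sub>R b + x))"
    proof (rule integrable_compact_support)
      show "compact ((+) (- (t i *\<^sub>R b)) ` K)" by (rule compact_translation[OF K])
      show "continuous_on ((+) (- (t i *\<^sub>R b)) ` K) (\<lambda>x. h (t i *\<^sub>R b + x))"
        by (rule continuous_on_compose2[OF hc]) (auto intro!: continuous_intros)
      fix x assume "x \<notin> (+) (- (t i *\<^sub>R b)) ` K"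
      then show "h (t i *\<^sub>R b + x) = 0"
        by (intro h0) (auto simp: image_iff algebra_simps)
    qed
    then have "(\<integral>x. h (t i *\<^sub>R b + x) - h x \<partial>lborel) = 0"
      using hI integral_lborel_translate[OF hb(1), of "t i *\<^sub>R b"] by simp
    moreover have "s i = (\<lambda>x. (h (t i *\<^sub>R b + x) - h x) / t i)"
      by (simp add: s_def fun_eq_iff add.commute)
    ultimately show ?thesis by (simp del: integral_diff)
  qed
  ultimately show ?thesis by (simp add: LIMSEQ_const_iff)
qed

lemma has_derivative_eq_0_open:
  assumes "(f has_derivative f') (at x)" "open T" "x \<in> T" "\<And>z. z \<in> T \<Longrightarrow> f z = 0"
  shows "f' = (\<lambda>h. 0)"
proof -
  have "((\<lambda>z. 0) has_derivative f') (at x)"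
    using assms by (rule has_derivative_transform_within_open)
  then show ?thesis
    by (rule has_derivative_unique) simp
qed

text \<open>This is the divergence theorem for the field \<open>G A\<close>: each component
  \<open>G x * (A x \<bullet> b)\<close> is differentiated in its own direction \<open>b\<close>,
  and the trace of \<open>A\<close> is the divergence of \<open>A\<close>.\<close>

lemma integral_linear_field:
  fixes G :: "'a::euclidean_space \<Rightarrow> real"
  assumes A: "linear A" and K: "compact K" and G0: "\<And>x. x \<notin> K \<Longrightarrow> G x = 0"
    and d: "\<And>x. (G has_derivative G' x) (at x)"
    and c: "\<And>b. b \<in> Basis \<Longrightarrow> continuous_on UNIV (\<lambda>x. G' x b)"
  shows "(\<integral>x. G' x (A x) + (\<Sum>b\<in>Basis. A b \<bullet> b) * G x \<partial>lborel) = 0"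
proof -
  have Gc: "continuous_on UNIV G"
    using d by (auto intro: continuous_at_imp_continuous_on has_derivative_continuous)
  have G'0: "G' x = (\<lambda>h. 0)" if "x \<notin> K" for x
    using d[of x] compact_imp_closed[OF K] that G0
    by (intro has_derivative_eq_0_open[of G _ x "- K"]) (auto simp: open_Compl)
  have Ac: "continuous_on S A" for S by (rule linear_continuous_on[OF linear_linear[THEN iffD2]]) (use A in \<open>simp add: linear_linear\<close>)
  have z: "(\<integral>x. G' x b * (A x \<bullet> b) + G x * (A b \<bullet> b) \<partial>lborel) = 0"
    and I: "integrable lborel (\<lambda>x. G' x b * (A x \<bullet> b) + G x * (A b \<bullet> b))" if b: "b \<in> Basis" for b
  proof -
    have cc: "continuous_on UNIV (\<lambda>x. G' x b * (A x \<bullet> b) + G x * (A b \<bullet> b))"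
      by (intro continuous_intros c b Gc Ac)
    show "integrable lborel (\<lambda>x. G' x b * (A x \<bullet> b) + G x * (A b \<bullet> b))"
      using K continuous_on_subset[OF cc] by (rule integrable_compact_support) (auto simp: G0 G'0)
    show "(\<integral>x. G' x b * (A x \<bullet> b) + G x * (A b \<bullet> b) \<partial>lborel) = 0"
    proof (rule integral_directional_derivative[OF K _ _ _ cc, where h = "\<lambda>x. G x * (A x \<bullet> b)" and b = b])
      show "continuous_on UNIV (\<lambda>x. G x * (A x \<bullet> b))"
        by (intro continuous_intros Gc Ac)
      fix x
      have lin: "linear (G' x)" using d by (rule has_derivative_linear)
      have 1: "((\<lambda>x. G x * (A x \<bullet> b)) has_derivative (\<lambda>z. G x * (A z \<bullet> b) + G' x z * (A x \<bullet> b))) (at x)"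
        by (intro has_derivative_mult d has_derivative_inner_left linear_imp_has_derivative[OF A])
      have "((\<lambda>t. G (x + t *\<^sub>R b) * (A (x + t *\<^sub>R b) \<bullet> b)) has_derivative
          (\<lambda>s. G x * (A (s *\<^sub>R b) \<bullet> b) + G' x (s *\<^sub>R b) * (A x \<bullet> b))) (at 0)"
        using 1 by (intro has_derivative_compose[of "\<lambda>t. x + t *\<^sub>R b" "\<lambda>s. s *\<^sub>R b" 0 UNIV "\<lambda>x. G x * (A x \<bullet> b)"])
          (auto intro!: derivative_eq_intros)
      moreover have "(\<lambda>s. G x * (A (s *\<^sub>R b) \<bullet> b) + G' x (s *\<^sub>R b) * (A x \<bullet> b)) =
          (*) (G' x b * (A x \<bullet> b) + G x * (A b \<bullet> b))"
        by (rule ext) (simp add: linear_cmul[OF lin] linear_cmul[OF A] algebra_simps)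
      ultimately show "((\<lambda>t. G (x + t *\<^sub>R b) * (A (x + t *\<^sub>R b) \<bullet> b)) has_real_derivative
          G' x b * (A x \<bullet> b) + G x * (A b \<bullet> b)) (at 0)"
        by (simp add: has_field_derivative_def)
    qed (auto simp: G0 G'0)
  qed
  have "G' x (A x) + (\<Sum>b\<in>Basis. A b \<bullet> b) * G x =
      (\<Sum>b\<in>Basis. G' x b * (A x \<bullet> b) + G x * (A b \<bullet> b))" for x
  proof -
    have lin: "linear (G' x)" using d by (rule has_derivative_linear)
    have "G' x (\<Sum>b\<in>Basis. (A x \<bullet> b) *\<^sub>R b) = (\<Sum>b\<in>Basis. G' x b * (A x \<bullet> b))"
      by (simp add: linear_sum[OF lin] linear_cmul[OF lin] mult.commute)
    then show ?thesis
      by (simp add: euclidean_representation sum.distrib sum_distrib_left mult.commute)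
  qed
  then show ?thesis by (simp add: z I)
qed

lemma field_deriv_eq_0:
  assumes "smooth u" "closed S" "\<And>x. x \<notin> S \<Longrightarrow> u x = 0" "x \<notin> S"
  shows "field_deriv A u x = 0"
  using has_derivative_eq_0_open[OF smooth_has_derivative[OF assms(1)], of "- S" x] assms(2-4)
  by (auto simp: field_deriv_def open_Compl)

text \<open>Radial weights vanish near the origin, so that the singularity of the Bessel potential and
  the behaviour at radius \<open>R\<close> do not matter: the latter lies outside the support of \<open>h\<close>.\<close>

lemma integrable_radial_mult:
  fixes h :: "'a::euclidean_space \<Rightarrow> real"
  assumes S: "compact S" "S \<subseteq> ball 0 R" and h: "continuous_on UNIV h" "\<And>x. x \<notin> S \<Longrightarrow> h x = 0"
    and "0 < \<epsilon>" and \<psi>: "\<And>r. r \<le> \<epsilon> \<Longrightarrow> \<psi> r = 0" "continuous_on {0<..<R} \<psi>"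
  shows "integrable lborel (\<lambda>x. \<psi> (norm x) * h x)"
proof (rule integrable_compact_support)
  show "compact (S \<inter> {x. \<epsilon> \<le> norm x})"
    by (intro compact_Int_closed S closed_Collect_le continuous_intros)
  show "continuous_on (S \<inter> {x. \<epsilon> \<le> norm x}) (\<lambda>x. \<psi> (norm x) * h x)"
    using S(2) \<open>0 < \<epsilon>\<close>
    by (intro continuous_on_mult continuous_on_subset[OF h(1)] continuous_on_compose2[OF \<psi>(2)])
      (auto intro!: continuous_intros simp: subset_iff)
  show "\<psi> (norm x) * h x = 0" if "x \<notin> S \<inter> {x. \<epsilon> \<le> norm x}" for x
    using that h(2)[of x] \<psi>(1)[of "norm x"] by auto
qed

text \<open>The divergence theorem for \<open>\<psi> (norm x) * h x\<close> times \<open>A\<close>.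
  The condition on \<open>x \<bullet> A x\<close> says that \<open>norm\<close> has derivative
  \<open>\<mu> * norm x\<close> along \<open>A\<close>; the cases of interest are the Euler field
  with \<open>\<mu> = 1\<close> and rotations with \<open>\<mu> = 0\<close>.\<close>

lemma radial_field_integral:
  fixes h :: "'a::euclidean_space \<Rightarrow> real"
  assumes S: "compact S" "S \<subseteq> ball 0 R" and h: "smooth h" "\<And>x. x \<notin> S \<Longrightarrow> h x = 0"
    and \<epsilon>: "0 < \<epsilon>" and \<psi>0: "\<And>r. r \<le> \<epsilon> \<Longrightarrow> \<psi> r = 0" "\<And>r. r \<le> \<epsilon> \<Longrightarrow> \<psi>' r = 0"
    and \<psi>: "\<And>r. r \<in> {0<..<R} \<Longrightarrow> (\<psi> has_real_derivative \<psi>' r) (at r)"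
    and \<psi>': "continuous_on {0<..<R} \<psi>'"
    and A: "linear A" "\<And>x. x \<bullet> A x = \<mu> * (norm x)\<^sup>2"
  shows "(\<integral>x. \<psi> (norm x) * field_deriv A h x
    + (\<mu> * norm x * \<psi>' (norm x) + (\<Sum>b\<in>Basis. A b \<bullet> b) * \<psi> (norm x)) * h x \<partial>lborel) = 0"
proof -
  define G where "G x = \<psi> (norm x) * h x" for x
  define Dh where "Dh x = frechet_derivative h (at x)" for x
  define G' where "G' x z = \<psi> (norm x) * Dh x z + \<psi>' (norm x) * (sgn x \<bullet> z) * h x" for x z
  define U where "U = {x::'a. 0 < norm x \<and> norm x < R}"
  have U: "open U" unfolding U_def
    by (intro open_Collect_conj open_Collect_less continuous_intros)
  have clS: "closed S" by (rule compact_imp_closed[OF S(1)])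
  have Dh: "(h has_derivative Dh x) (at x)" for x
    unfolding Dh_def by (rule smooth_has_derivative[OF h(1)])
  have Dh0: "Dh x z = 0" if "x \<notin> S" for x z
    using has_derivative_eq_0_open[OF Dh, of "- S" x] that h(2) clS by (auto simp: open_Compl)
  have Dhc: "continuous_on T (\<lambda>x. Dh x b)" if "b \<in> Basis" for b T
    using smooth_continuous[OF smooth_partial_deriv[OF h(1) that]] by (simp add: partial_deriv_def Dh_def)
  have hc: "continuous_on T h" for T by (rule smooth_continuous[OF h(1)])
  have \<psi>c: "continuous_on {0<..<R} \<psi>"
    by (rule continuous_at_imp_continuous_on) (auto intro: DERIV_isCont \<psi>)
  \<comment> \<open>Three open sets cover the space: on the punctured ball the product rule applies,
    and on the other two \<open>G\<close> vanishes identically. Differentiability and continuity are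
    checked on each.\<close>
  have cover: "x \<in> U \<or> x \<in> ball 0 \<epsilon> \<or> x \<in> - S" for x
    using S(2) \<epsilon> by (cases "x = 0") (auto simp: U_def subset_iff)
  have zero: "G x = 0" "G' x z = 0" if "x \<in> ball 0 \<epsilon> \<or> x \<in> - S" for x z
    using that by (auto simp: G_def G'_def \<psi>0 h(2) Dh0)
  have "(\<integral>x. G' x (A x) + (\<Sum>b\<in>Basis. A b \<bullet> b) * G x \<partial>lborel) = 0"
  proof (rule integral_linear_field[OF A(1) S(1)])
    show "G x = 0" if "x \<notin> S" for x using that by (intro zero) auto
    show "(G has_derivative G' x) (at x)" for x
    proof (cases "x \<in> U")
      case True
      have n: "(norm has_derivative (\<lambda>z. sgn x \<bullet> z)) (at x)"
        using True has_derivative_norm[of x] by (auto simp: U_def inner_commute)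
      have "(\<psi> has_derivative (*) (\<psi>' (norm x))) (at (norm x))"
        using True \<psi>[of "norm x"] by (auto simp: U_def has_field_derivative_def)
      from has_derivative_compose[OF n this]
      have "((\<lambda>x. \<psi> (norm x)) has_derivative (\<lambda>z. \<psi>' (norm x) * (sgn x \<bullet> z))) (at x)" .
      from has_derivative_mult[OF this Dh] show ?thesis
        unfolding G_def G'_def .
    next
      case False
      then have x: "x \<in> ball 0 \<epsilon> \<union> - S" using cover by auto
      have "((\<lambda>z. 0) has_derivative (\<lambda>z. 0)) (at x)" by simp
      then have "(G has_derivative (\<lambda>z. 0)) (at x)"
        by (rule has_derivative_transform_within_open[of _ _ _ _ "ball 0 \<epsilon> \<union> - S"])
          (use x zero(1) clS in \<open>auto simp: open_Compl\<close>)
      moreover have "G' x = (\<lambda>z. 0)" using x by (intro ext zero) auto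
      ultimately show ?thesis by simp
    qed
    show "continuous_on UNIV (\<lambda>x. G' x b)" if b: "b \<in> Basis" for b
    proof -
      have "continuous_on U (\<lambda>x. G' x b)"
        unfolding G'_def
        by (intro continuous_intros Dhc b hc continuous_on_compose2[OF \<psi>c] continuous_on_compose2[OF \<psi>'])
          (auto simp: U_def)
      moreover have "continuous_on (ball 0 \<epsilon> \<union> - S) (\<lambda>x. G' x b)"
        by (subst continuous_on_cong[OF refl, of _ _ "\<lambda>x. 0"]) (auto simp: zero)
      moreover have "open (ball 0 \<epsilon> \<union> - S)" using clS by (intro open_Un open_ball open_Compl)
      ultimately have "continuous_on (U \<union> (ball 0 \<epsilon> \<union> - S)) (\<lambda>x. G' x b)"
        using U by (metis continuous_on_open_Un)
      moreover have "x \<in> U \<union> (ball 0 \<epsilon> \<union> - S)" for x using cover[of x] by blast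
      then have "U \<union> (ball 0 \<epsilon> \<union> - S) = UNIV" by blast
      ultimately show ?thesis by simp
    qed
  qed
  moreover have "G' x (A x) + (\<Sum>b\<in>Basis. A b \<bullet> b) * G x = \<psi> (norm x) * field_deriv A h x
    + (\<mu> * norm x * \<psi>' (norm x) + (\<Sum>b\<in>Basis. A b \<bullet> b) * \<psi> (norm x)) * h x" for x
  proof -
    have "sgn x \<bullet> A x = \<mu> * norm x"
      by (cases "x = 0") (auto simp: sgn_div_norm A(2) power2_eq_square)
    then show ?thesis
      by (simp add: G'_def G_def Dh_def field_deriv_def algebra_simps)
  qed
  ultimately show ?thesis by simp
qed

section \<open>Radial cutoffs\<close>

text \<open>A monotone C1 transition from 0 on \<open>t \<le> 1\<close> to 1 on
  \<open>t \<ge> 2\<close>. Only one derivative of the cutoff is ever taken, so nested squares of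
  positive parts suffice.\<close>

definition cutoff_step :: "real \<Rightarrow> real"
  where "cutoff_step t = 1 - (max 0 (1 - (max 0 (t - 1))\<^sup>2))\<^sup>2"

definition cutoff_step' :: "real \<Rightarrow> real"
  where "cutoff_step' t = 4 * max 0 (1 - (max 0 (t - 1))\<^sup>2) * max 0 (t - 1)"

lemma cutoff_step_eq_0: "t \<le> 1 \<Longrightarrow> cutoff_step t = 0"
  and cutoff_step'_eq_0: "t \<le> 1 \<Longrightarrow> cutoff_step' t = 0"
  by (simp_all add: cutoff_step_def cutoff_step'_def max_def)

lemma cutoff_step_ge_2: assumes "2 \<le> t" shows "cutoff_step t = 1" "cutoff_step' t = 0"
proof -
  have "1 \<le> (t - 1)\<^sup>2" using assms by (simp add: one_le_power)
  then have "max 0 (1 - (t - 1)\<^sup>2) = 0" by (intro max_absorb1) linarith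
  moreover have "max 0 (t - 1) = t - 1" using assms by simp
  ultimately show "cutoff_step t = 1" "cutoff_step' t = 0" by (simp_all only: cutoff_step_def cutoff_step'_def) simp_all
qed

lemma cutoff_step_bounds: "0 \<le> cutoff_step t" "cutoff_step t \<le> 1"
proof -
  have "(max 0 (1 - (max 0 (t - 1))\<^sup>2))\<^sup>2 \<le> 1"
    by (intro power_le_one) (auto simp: max_def)
  then show "0 \<le> cutoff_step t" "cutoff_step t \<le> 1" by (simp_all add: cutoff_step_def)
qed

lemma cutoff_step'_bounds: "0 \<le> cutoff_step' t" "cutoff_step' t \<le> 4"
proof -
  show "0 \<le> cutoff_step' t" by (simp add: cutoff_step'_def)
  show "cutoff_step' t \<le> 4"
  proof (cases "t \<le> 2")
    case True
    have "max 0 (1 - (max 0 (t - 1))\<^sup>2) * max 0 (t - 1) \<le> 1 * 1"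
      by (intro mult_mono) (use True in \<open>auto simp: max_def\<close>)
    then show ?thesis by (simp add: cutoff_step'_def)
  qed (simp add: cutoff_step_ge_2)
qed

text \<open>Squaring removes the corner of the positive part: at 0 the difference quotient is
  \<open>max 0 h\<close>, which tends to 0.\<close>

lemma has_real_derivative_max_square: "((\<lambda>t. (max 0 t)\<^sup>2) has_real_derivative 2 * max 0 t) (at (t::real))"
proof (cases t "0::real" rule: linorder_cases)
  case less
  have "((\<lambda>t. 0) has_real_derivative 2 * max 0 t) (at t)" using less by simp
  then show ?thesis
    by (rule DERIV_cong_ev[THEN iffD1, rotated 3]) (use less eventually_nhds_in_open[of "{..<0}" t] in \<open>auto elim!: eventually_mono\<close>)
next
  case equal
  have "((\<lambda>h::real. max 0 h) \<longlongrightarrow> max 0 0) (at 0)" by (intro tendsto_intros)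
  then have "((\<lambda>h::real. (max 0 h)\<^sup>2 / h) \<longlongrightarrow> max 0 0) (at 0)"
    by (rule Lim_transform_eventually) (auto simp: eventually_at_filter max_def power2_eq_square)
  then show ?thesis using equal by (simp add: has_field_derivative_iff)
next
  case greater
  have "((\<lambda>t. t\<^sup>2) has_real_derivative 2 * max 0 t) (at t)"
    using greater by (auto intro!: derivative_eq_intros)
  then show ?thesis
    by (rule DERIV_cong_ev[THEN iffD1, rotated 3]) (use greater eventually_nhds_in_open[of "{0<..}" t] in \<open>auto elim!: eventually_mono\<close>)
qed

lemma has_real_derivative_max_square_compose:
  fixes g :: "real \<Rightarrow> real"
  assumes "(g has_real_derivative g') (at t)"
  shows "((\<lambda>t. (max 0 (g t))\<^sup>2) has_real_derivative 2 * max 0 (g t) * g') (at t)"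
  by (rule DERIV_chain2[where f = "\<lambda>t. (max 0 t)\<^sup>2", OF has_real_derivative_max_square assms])

lemma has_real_derivative_cutoff_step: "(cutoff_step has_real_derivative cutoff_step' t) (at t)"
proof -
  have 1: "((\<lambda>t. (max 0 (t - 1))\<^sup>2) has_real_derivative 2 * max 0 (t - 1)) (at t)"
    using has_real_derivative_max_square_compose[of "\<lambda>t. t - 1" 1 t]
    by (simp add: DERIV_diff[OF DERIV_ident DERIV_const, simplified])
  have 2: "((\<lambda>t. 1 - (max 0 (t - 1))\<^sup>2) has_real_derivative - (2 * max 0 (t - 1))) (at t)"
    using DERIV_diff[OF DERIV_const 1, of 1] by simp
  have "((\<lambda>t. (max 0 (1 - (max 0 (t - 1))\<^sup>2))\<^sup>2) has_real_derivative - cutoff_step' t) (at t)"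
    using has_real_derivative_max_square_compose[OF 2] by (simp add: cutoff_step'_def mult_ac)
  from DERIV_diff[OF DERIV_const this, of 1] show ?thesis
    unfolding cutoff_step_def[abs_def] by simp
qed

lemma continuous_on_cutoff_step': "continuous_on S cutoff_step'"
  unfolding cutoff_step'_def[abs_def] by (intro continuous_intros)

lemma continuous_on_cutoff_step: "continuous_on S cutoff_step"
  unfolding cutoff_step_def[abs_def] by (intro continuous_intros)

text \<open>Here \<open>cut_error\<close> is \<open>r\<^sup>-\<^sup>4\<close> times the Euler derivative of the cutoff \<open>cutoff_step (r / \<epsilon>)\<close>.\<close>

definition cut_weight :: "real \<Rightarrow> real \<Rightarrow> real"
  where "cut_weight \<epsilon> r = cutoff_step (r / \<epsilon>) / r ^ 4"

definition cut_error :: "real \<Rightarrow> real \<Rightarrow> real"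
  where "cut_error \<epsilon> r = r / \<epsilon> * cutoff_step' (r / \<epsilon>) / r ^ 4"

text \<open>The form over \<open>r\<close> displays the Euler derivative of the weight: the cutoff
  gives \<open>cut_error\<close>, and the power of \<open>r\<close> gives the \<open>- 4\<close>
  that later turns the dimension into the dimension minus 4.\<close>

lemma has_real_derivative_cut_weight:
  assumes "0 < \<epsilon>" "0 < r"
  shows "(cut_weight \<epsilon> has_real_derivative (cut_error \<epsilon> r - 4 * cut_weight \<epsilon> r) / r) (at r)"
proof -
  have "((\<lambda>r. cutoff_step (r / \<epsilon>)) has_real_derivative cutoff_step' (r / \<epsilon>) * (1 / \<epsilon>)) (at r)"
    using assms by (intro DERIV_chain2[OF has_real_derivative_cutoff_step]) (auto intro!: derivative_eq_intros)
  then have "(cut_weight \<epsilon> has_real_derivative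
      (cutoff_step' (r / \<epsilon>) * (1 / \<epsilon>) * r ^ 4 - cutoff_step (r / \<epsilon>) * (4 * r ^ 3)) / (r ^ 4 * r ^ 4)) (at r)"
    unfolding cut_weight_def[abs_def] using assms by (auto intro!: derivative_eq_intros)
  moreover have "(cutoff_step' (r / \<epsilon>) * (1 / \<epsilon>) * r ^ 4 - cutoff_step (r / \<epsilon>) * (4 * r ^ 3)) / (r ^ 4 * r ^ 4)
      = (cut_error \<epsilon> r - 4 * cut_weight \<epsilon> r) / r"
    using assms by (simp add: cut_weight_def cut_error_def divide_simps) (simp add: algebra_simps eval_nat_numeral)
  ultimately show ?thesis by simp
qed

lemma cut_weight_nonneg: "0 \<le> cut_weight \<epsilon> r"
  by (simp add: cut_weight_def cutoff_step_bounds)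

lemma cut_error_nonneg: "0 < \<epsilon> \<Longrightarrow> 0 \<le> cut_error \<epsilon> r"
proof -
  assume "0 < \<epsilon>"
  then have "0 \<le> r / \<epsilon> * cutoff_step' (r / \<epsilon>)"
    by (cases "0 \<le> r") (auto simp: cutoff_step'_bounds cutoff_step'_eq_0 field_simps)
  then show ?thesis unfolding cut_error_def by (rule divide_nonneg_nonneg) simp
qed

lemma cut_weight_eq_0: "0 < \<epsilon> \<Longrightarrow> r \<le> \<epsilon> \<Longrightarrow> cut_weight \<epsilon> r = 0"
  and cut_error_eq_0: "0 < \<epsilon> \<Longrightarrow> r \<le> \<epsilon> \<Longrightarrow> cut_error \<epsilon> r = 0"
  by (simp_all add: cut_weight_def cut_error_def cutoff_step_eq_0 cutoff_step'_eq_0)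

text \<open>The error lives on \<open>\<epsilon> \<le> r \<le> 2 * \<epsilon>\<close>, where
  \<open>r / \<epsilon>\<close> is at most 2 and the slope of the step at most 4; this is the origin
  of the 8.\<close>

lemma cut_error_bound:
  assumes "0 < \<epsilon>" shows "r\<^sup>2 * cut_error \<epsilon> r \<le> 8 / \<epsilon>\<^sup>2" "2 * \<epsilon> \<le> r \<Longrightarrow> cut_error \<epsilon> r = 0"
proof -
  show z: "cut_error \<epsilon> r = 0" if "2 * \<epsilon> \<le> r"
    using assms that by (simp add: cut_error_def cutoff_step_ge_2 field_simps)
  show "r\<^sup>2 * cut_error \<epsilon> r \<le> 8 / \<epsilon>\<^sup>2"
  proof (cases "r \<le> \<epsilon> \<or> 2 * \<epsilon> \<le> r")
    case True then show ?thesis using z cut_error_eq_0[OF assms] by auto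
  next
    case False
    then have r: "\<epsilon> \<le> r" "r / \<epsilon> \<le> 2" "0 < r" using assms by (auto simp: field_simps)
    have le: "r / \<epsilon> * cutoff_step' (r / \<epsilon>) \<le> 2 * 4"
      using r assms cutoff_step'_bounds by (intro mult_mono) auto
    have "r\<^sup>2 * cut_error \<epsilon> r = r / \<epsilon> * cutoff_step' (r / \<epsilon>) / r\<^sup>2"
      using r by (simp add: cut_error_def divide_simps)
    also have "\<dots> \<le> (2 * 4) / r\<^sup>2" by (rule divide_right_mono[OF le]) simp
    also have "\<dots> \<le> (2 * 4) / \<epsilon>\<^sup>2"
      using r assms by (intro divide_left_mono power_mono) auto
    finally show ?thesis by simp
  qed
qed

section \<open>Integral inequalities with the radial cutoff\<close>

locale radial_cutoff =
  fixes R \<epsilon> :: real and S :: "'a::euclidean_space set"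
  assumes eps_pos: "0 < \<epsilon>" and compact_S: "compact S" and S_subset: "S \<subseteq> ball 0 R"
begin

text \<open>A fixed set \<open>S\<close>, instead of the support of each single function, makes the
  predicate stable under sums, products and linear fields. It does not involve
  \<open>\<epsilon>\<close>, so it survives the limit in \<open>\<epsilon>\<close>.\<close>

definition supported :: "('a \<Rightarrow> real) \<Rightarrow> bool"
  where "supported h \<longleftrightarrow> smooth h \<and> (\<forall>x. x \<notin> S \<longrightarrow> h x = 0)"

lemma supported_eq_0: "supported h \<Longrightarrow> x \<notin> S \<Longrightarrow> h x = 0"
  by (simp add: supported_def)

lemma supported_smooth: "supported h \<Longrightarrow> smooth h"
  by (simp add: supported_def)

lemma supported_add: "supported f \<Longrightarrow> supported g \<Longrightarrow> supported (\<lambda>x. f x + g x)"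
  and supported_mult: "supported f \<Longrightarrow> supported g \<Longrightarrow> supported (\<lambda>x. f x * g x)"
  and supported_cmult: "supported f \<Longrightarrow> supported (\<lambda>x. c * f x)"
  by (simp_all add: supported_def smooth_add smooth_mult smooth_const)

lemma supported_sum: "(\<And>i. i \<in> I \<Longrightarrow> supported (f i)) \<Longrightarrow> supported (\<lambda>x. \<Sum>i\<in>I. f i x)"
  by (auto simp: supported_def intro: smooth_sum)

lemma supported_field_deriv: "linear A \<Longrightarrow> supported h \<Longrightarrow> supported (field_deriv A h)"
  using field_deriv_eq_0[of h S _ A] compact_imp_closed[OF compact_S]
  by (auto simp: supported_def smooth_field_deriv)

lemma continuous_on_cut_weight: "continuous_on {0<..<R} (cut_weight \<epsilon>)"
  and continuous_on_cut_error: "continuous_on {0<..<R} (cut_error \<epsilon>)"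
  unfolding cut_weight_def[abs_def] cut_error_def[abs_def]
  by (intro continuous_intros continuous_on_compose2[OF continuous_on_cutoff_step[of UNIV]]
      continuous_on_compose2[OF continuous_on_cutoff_step'[of UNIV]]; use eps_pos in auto)+

lemma integrable_cut_weight:
  assumes \<omega>: "continuous_on {0<..<R} \<omega>" and h: "supported h"
  shows "integrable lborel (\<lambda>x. cut_weight \<epsilon> (norm x) * (\<omega> (norm x) * h x))"
proof -
  have "integrable lborel (\<lambda>x. (cut_weight \<epsilon> (norm x) * \<omega> (norm x)) * h x)"
    by (rule integrable_radial_mult[OF compact_S S_subset smooth_continuous[OF supported_smooth[OF h]]
        supported_eq_0[OF h] eps_pos, of "\<lambda>r. cut_weight \<epsilon> r * \<omega> r"])
      (simp_all add: cut_weight_eq_0[OF eps_pos] continuous_on_mult continuous_on_cut_weight \<omega>)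
  then show ?thesis by (simp add: mult.assoc)
qed

lemma integrable_cut_error:
  assumes \<omega>: "continuous_on {0<..<R} \<omega>" and h: "supported h"
  shows "integrable lborel (\<lambda>x. cut_error \<epsilon> (norm x) * (\<omega> (norm x) * h x))"
proof -
  have "integrable lborel (\<lambda>x. (cut_error \<epsilon> (norm x) * \<omega> (norm x)) * h x)"
    by (rule integrable_radial_mult[OF compact_S S_subset smooth_continuous[OF supported_smooth[OF h]]
        supported_eq_0[OF h] eps_pos, of "\<lambda>r. cut_error \<epsilon> r * \<omega> r"])
      (simp_all add: cut_error_eq_0[OF eps_pos] continuous_on_mult continuous_on_cut_error \<omega>)
  then show ?thesis by (simp add: mult.assoc)
qed

lemma integrable_cut_weight1: "supported h \<Longrightarrow> integrable lborel (\<lambda>x. cut_weight \<epsilon> (norm x) * h x)"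
  using integrable_cut_weight[of "\<lambda>r. 1" h] by simp

lemma integrable_euler:
  assumes h: "supported h" and kc: "continuous_on {0<..<R} k" and k': "continuous_on {0<..<R} k'"
  shows "integrable lborel (\<lambda>x. cut_weight \<epsilon> (norm x) * (k (norm x) * euler h x
      + (norm x * k' (norm x) + (real DIM('a) - 4) * k (norm x)) * h x))"
proof -
  have "integrable lborel (\<lambda>x. cut_weight \<epsilon> (norm x) * (k (norm x) * euler h x))"
    by (intro integrable_cut_weight kc supported_field_deriv linear_ident h)
  moreover have "integrable lborel (\<lambda>x. cut_weight \<epsilon> (norm x) *
      ((norm x * k' (norm x) + (real DIM('a) - 4) * k (norm x)) * h x))"
    by (intro integrable_cut_weight[of "\<lambda>r. r * k' r + (real DIM('a) - 4) * k r"] continuous_intros kc k' h)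
  ultimately show ?thesis by (simp add: distrib_left)
qed

text \<open>Integration by parts along the Euler field with radial coefficient
  \<open>cut_weight \<epsilon> r * k r\<close>. Its divergence, the dimension, combines with the
  \<open>- 4\<close> of the weight, and the derivative of the cutoff is moved to the right.\<close>

lemma euler_integral:
  assumes h: "supported h"
    and k: "\<And>r. r \<in> {0<..<R} \<Longrightarrow> (k has_real_derivative k' r) (at r)"
    and k': "continuous_on {0<..<R} k'"
  shows "(\<integral>x. cut_weight \<epsilon> (norm x) * (k (norm x) * euler h x
      + (norm x * k' (norm x) + (real DIM('a) - 4) * k (norm x)) * h x) \<partial>lborel)
    = - (\<integral>x. cut_error \<epsilon> (norm x) * (k (norm x) * h x) \<partial>lborel)"
proof -
  have kc: "continuous_on {0<..<R} k"
    by (rule continuous_at_imp_continuous_on) (auto intro: DERIV_isCont k)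
  define \<psi> where "\<psi> r = cut_weight \<epsilon> r * k r" for r
  define \<psi>' where "\<psi>' r = cut_weight \<epsilon> r * k' r + (cut_error \<epsilon> r - 4 * cut_weight \<epsilon> r) / r * k r" for r
  have "(\<integral>x. \<psi> (norm x) * euler h x
    + (1 * norm x * \<psi>' (norm x) + (\<Sum>b\<in>(Basis::'a set). b \<bullet> b) * \<psi> (norm x)) * h x \<partial>lborel) = 0"
  proof (rule radial_field_integral[OF compact_S S_subset supported_smooth[OF h] supported_eq_0[OF h] eps_pos,
        where A = "\<lambda>x. x" and \<mu> = 1 and \<psi> = \<psi> and \<psi>' = \<psi>'])
    show "(\<psi> has_real_derivative \<psi>' r) (at r)" if "r \<in> {0<..<R}" for r
      unfolding \<psi>_def[abs_def] \<psi>'_def using that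
      by (intro DERIV_mult' has_real_derivative_cut_weight k eps_pos) auto
    show "continuous_on {0<..<R} \<psi>'"
      unfolding \<psi>'_def[abs_def] by (intro continuous_intros continuous_on_cut_weight continuous_on_cut_error k' kc) auto
  qed (auto simp: \<psi>_def \<psi>'_def cut_weight_eq_0[OF eps_pos] cut_error_eq_0[OF eps_pos] power2_norm_eq_inner linear_ident)
  moreover have "\<psi> (norm x) * euler h x + (1 * norm x * \<psi>' (norm x) + (\<Sum>b\<in>(Basis::'a set). b \<bullet> b) * \<psi> (norm x)) * h x
    = cut_weight \<epsilon> (norm x) * (k (norm x) * euler h x
      + (norm x * k' (norm x) + (real DIM('a) - 4) * k (norm x)) * h x) + cut_error \<epsilon> (norm x) * (k (norm x) * h x)" for x :: 'a
    using eps_pos by (cases "x = 0") (auto simp: \<psi>_def \<psi>'_def cut_weight_eq_0 cut_error_eq_0 field_simps)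
  moreover note integrable_euler[OF h kc k']
  ultimately show ?thesis
    using integrable_cut_error[OF kc h] by simp
qed

text \<open>Integrated form of a pointwise inequality that holds up to the divergence of the radial field
  with coefficient \<open>k h\<close>.\<close>

lemma euler_integral_le:
  assumes h: "supported h"
    and k: "\<And>r. r \<in> {0<..<R} \<Longrightarrow> (k has_real_derivative k' r) (at r)"
    and k': "continuous_on {0<..<R} k'"
    and F: "continuous_on {0<..<R} \<phi>" "supported f" and G: "continuous_on {0<..<R} \<gamma>" "supported g"
    and le: "\<And>x. 0 < norm x \<Longrightarrow> norm x < R \<Longrightarrow>
      \<gamma> (norm x) * g x + (k (norm x) * euler h x
        + (norm x * k' (norm x) + (real DIM('a) - 4) * k (norm x)) * h x) \<le> \<phi> (norm x) * f x"
  shows "(\<integral>x. cut_weight \<epsilon> (norm x) * (\<gamma> (norm x) * g x) \<partial>lborel)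
      - (\<integral>x. cut_error \<epsilon> (norm x) * (k (norm x) * h x) \<partial>lborel)
    \<le> (\<integral>x. cut_weight \<epsilon> (norm x) * (\<phi> (norm x) * f x) \<partial>lborel)"
proof -
  have kc: "continuous_on {0<..<R} k"
    by (rule continuous_at_imp_continuous_on) (auto intro: DERIV_isCont k)
  note I = integrable_euler[OF h kc k']
  have "(\<integral>x. cut_weight \<epsilon> (norm x) * (\<gamma> (norm x) * g x) + cut_weight \<epsilon> (norm x) * (k (norm x) * euler h x
      + (norm x * k' (norm x) + (real DIM('a) - 4) * k (norm x)) * h x) \<partial>lborel)
    \<le> (\<integral>x. cut_weight \<epsilon> (norm x) * (\<phi> (norm x) * f x) \<partial>lborel)"
  proof (rule integral_mono)
    fix x
    show "cut_weight \<epsilon> (norm x) * (\<gamma> (norm x) * g x) + cut_weight \<epsilon> (norm x) * (k (norm x) * euler h x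
        + (norm x * k' (norm x) + (real DIM('a) - 4) * k (norm x)) * h x)
      \<le> cut_weight \<epsilon> (norm x) * (\<phi> (norm x) * f x)"
    \<comment> \<open>At the origin the weight vanishes and outside the ball all the functions do,
      so the pointwise hypothesis is needed on the punctured ball only.\<close>
    proof (cases "x = 0 \<or> R \<le> norm x")
      case True
      then have "cut_weight \<epsilon> (norm x) = 0 \<or> x \<notin> S"
        using eps_pos S_subset by (auto simp: cut_weight_eq_0)
      then show ?thesis
        using supported_eq_0[OF h, of x] supported_eq_0[OF F(2), of x] supported_eq_0[OF G(2), of x]
          supported_eq_0[OF supported_field_deriv[OF linear_ident h], of x] by auto
    next
      case False
      then show ?thesis
        unfolding distrib_left[symmetric] by (intro mult_left_mono le cut_weight_nonneg) auto
    qed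
  qed (intro I integrable_cut_weight F G Bochner_Integration.integrable_add)+
  then show ?thesis
    using euler_integral[OF h k k'] integrable_cut_weight[OF G] I by simp
qed

text \<open>Expand the square of \<open>euler u x - p (norm x) * u x\<close>. The cross term is
  \<open>p\<close> times the Euler derivative of the square of \<open>u\<close>, so integrating by
  parts leaves the Riccati expression that bounds \<open>V\<close>.\<close>

lemma hardy_with_potential:
  assumes u: "supported u"
    and p: "\<And>r. r \<in> {0<..<R} \<Longrightarrow> (p has_real_derivative p' r) (at r)" "continuous_on {0<..<R} p'"
    and V: "continuous_on {0<..<R} V"
      "\<And>r. r \<in> {0<..<R} \<Longrightarrow> V r \<le> - (r * p' r + (p r)\<^sup>2 + (real DIM('a) - 4) * p r)"
  shows "(\<integral>x. cut_weight \<epsilon> (norm x) * (V (norm x) * (u x * u x)) \<partial>lborel)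
      - (\<integral>x. cut_error \<epsilon> (norm x) * (p (norm x) * (u x * u x)) \<partial>lborel)
    \<le> (\<integral>x. cut_weight \<epsilon> (norm x) * (euler u x * euler u x) \<partial>lborel)"
proof -
  have uu: "supported (\<lambda>x. u x * u x)" and EE: "supported (\<lambda>x. euler u x * euler u x)"
    by (intro supported_mult u supported_field_deriv linear_ident)+
  have "(\<integral>x. cut_weight \<epsilon> (norm x) * (V (norm x) * (u x * u x)) \<partial>lborel)
      - (\<integral>x. cut_error \<epsilon> (norm x) * (p (norm x) * (u x * u x)) \<partial>lborel)
    \<le> (\<integral>x. cut_weight \<epsilon> (norm x) * (1 * (euler u x * euler u x)) \<partial>lborel)"
  proof (rule euler_integral_le[OF uu p continuous_on_const EE V(1) uu])
    fix x :: 'a assume x: "0 < norm x" "norm x < R"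
    let ?r = "norm x" and ?n = "real DIM('a)"
    have "V ?r * (u x * u x) \<le> - (?r * p' ?r + (p ?r)\<^sup>2 + (?n - 4) * p ?r) * (u x * u x)"
      using x by (intro mult_right_mono V(2)) auto
    moreover have "euler (\<lambda>x. u x * u x) x = 2 * (u x * euler u x)"
      by (simp add: field_deriv_mult supported_smooth u)
    moreover have "0 \<le> (euler u x - p ?r * u x)\<^sup>2" by simp
    ultimately show "V ?r * (u x * u x) + (p ?r * euler (\<lambda>x. u x * u x) x
        + (?r * p' ?r + (?n - 4) * p ?r) * (u x * u x)) \<le> 1 * (euler u x * euler u x)"
      by (simp add: algebra_simps power2_eq_square)
  qed
  then show ?thesis by simp
qed

text \<open>The divergence term, now with coefficient \<open>p r + (real DIM('a) - 2)\<close>,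
  reduces the square of \<open>b\<close> to the square of
  \<open>euler w x - p (norm x) * w x\<close>. With n the dimension, the extra constant is (n - 2)^2
  - (n - 4)(n - 2) = 2(n - 2).\<close>

lemma radial_rellich_with_potential:
  assumes w: "supported w"
    and p: "\<And>r. r \<in> {0<..<R} \<Longrightarrow> (p has_real_derivative p' r) (at r)" "continuous_on {0<..<R} p'"
    and V: "continuous_on {0<..<R} V"
      "\<And>r. r \<in> {0<..<R} \<Longrightarrow> V r \<le> 2 * (real DIM('a) - 2) - (r * p' r + (p r)\<^sup>2 + (real DIM('a) - 4) * p r)"
  defines "b \<equiv> \<lambda>x. euler w x + (real DIM('a) - 2) * w x"
  shows "(\<integral>x. cut_weight \<epsilon> (norm x) * (V (norm x) * (w x * w x)) \<partial>lborel)
      - (\<integral>x. cut_error \<epsilon> (norm x) * ((p (norm x) + (real DIM('a) - 2)) * (w x * w x)) \<partial>lborel)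
    \<le> (\<integral>x. cut_weight \<epsilon> (norm x) * (b x * b x) \<partial>lborel)"
proof -
  let ?n = "real DIM('a)"
  let ?k = "\<lambda>r. p r + (?n - 2)"
  have ww: "supported (\<lambda>x. w x * w x)" and bb: "supported (\<lambda>x. b x * b x)"
    unfolding b_def by (intro supported_mult supported_add supported_cmult w supported_field_deriv linear_ident)+
  have k: "(?k has_real_derivative p' r) (at r)" if "r \<in> {0<..<R}" for r
    using p(1)[OF that] by (auto intro!: derivative_eq_intros)
  have "(\<integral>x. cut_weight \<epsilon> (norm x) * (V (norm x) * (w x * w x)) \<partial>lborel)
      - (\<integral>x. cut_error \<epsilon> (norm x) * (?k (norm x) * (w x * w x)) \<partial>lborel)
    \<le> (\<integral>x. cut_weight \<epsilon> (norm x) * (1 * (b x * b x)) \<partial>lborel)"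
  proof (rule euler_integral_le[OF ww k p(2) continuous_on_const bb V(1) ww])
    fix x :: 'a assume x: "0 < norm x" "norm x < R"
    let ?r = "norm x"
    have "V ?r * (w x * w x) \<le> (2 * (?n - 2) - (?r * p' ?r + (p ?r)\<^sup>2 + (?n - 4) * p ?r)) * (w x * w x)"
      using x by (intro mult_right_mono V(2)) auto
    moreover have "euler (\<lambda>x. w x * w x) x = 2 * (w x * euler w x)"
      by (simp add: field_deriv_mult supported_smooth w)
    moreover have "0 \<le> (euler w x - p ?r * w x)\<^sup>2" by simp
    ultimately show "V ?r * (w x * w x) + (?k ?r * euler (\<lambda>x. w x * w x) x
        + (?r * p' ?r + (?n - 4) * ?k ?r) * (w x * w x)) \<le> 1 * (b x * b x)"
      by (simp add: b_def algebra_simps power2_eq_square)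
  qed
  then show ?thesis by simp
qed

text \<open>Expand the square of \<open>euler u x + a * u x\<close> with weight
  \<open>W r * r\<^sup>2\<close>. The growth condition on \<open>W\<close> bounds the divergence of
  the cross term, and the value of \<open>a\<close> makes that bound twice the square of
  \<open>a\<close>.\<close>

lemma weighted_hardy:
  assumes u: "supported u"
    and W: "\<And>r. r \<in> {0<..<R} \<Longrightarrow> (W has_real_derivative W' r) (at r)" "continuous_on {0<..<R} W'"
      "\<And>r. r \<in> {0<..<R} \<Longrightarrow> 0 \<le> W r"
      "\<And>r. r \<in> {0<..<R} \<Longrightarrow> - lam * W r \<le> r * W' r"
    and a: "a = (real DIM('a) - lam - 2) / 2" "0 \<le> a"
  shows "a\<^sup>2 * (\<integral>x. cut_weight \<epsilon> (norm x) * ((W (norm x) * (norm x)\<^sup>2) * (u x * u x)) \<partial>lborel)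
    \<le> (\<integral>x. cut_weight \<epsilon> (norm x) * ((W (norm x) * (norm x)\<^sup>2) * (euler u x * euler u x)) \<partial>lborel)"
proof -
  let ?n = "real DIM('a)"
  let ?k = "\<lambda>r. - a * (W r * r\<^sup>2)" and ?k' = "\<lambda>r. - a * (W' r * r\<^sup>2 + W r * (2 * r))"
  have Wc: "continuous_on {0<..<R} W"
    by (rule continuous_at_imp_continuous_on) (auto intro: DERIV_isCont W)
  have uu: "supported (\<lambda>x. u x * u x)" and EE: "supported (\<lambda>x. euler u x * euler u x)"
    by (intro supported_mult u supported_field_deriv linear_ident)+
  have W2c: "continuous_on {0<..<R} (\<lambda>r. W r * r\<^sup>2)"
    by (intro continuous_intros Wc)
  have k'c: "continuous_on {0<..<R} ?k'"
    by (intro continuous_intros Wc W(2))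
  have k: "(?k has_real_derivative ?k' r) (at r)" if "r \<in> {0<..<R}" for r
    using W(1)[OF that] by (auto intro!: derivative_eq_intros simp: algebra_simps)
  have "(\<integral>x. cut_weight \<epsilon> (norm x) * ((W (norm x) * (norm x)\<^sup>2) * (a\<^sup>2 * (u x * u x))) \<partial>lborel)
      - (\<integral>x. cut_error \<epsilon> (norm x) * (?k (norm x) * (u x * u x)) \<partial>lborel)
    \<le> (\<integral>x. cut_weight \<epsilon> (norm x) * ((W (norm x) * (norm x)\<^sup>2) * (euler u x * euler u x)) \<partial>lborel)"
  proof (rule euler_integral_le[OF uu k k'c W2c EE W2c supported_cmult[OF uu]])
    fix x :: 'a assume x: "0 < norm x" "norm x < R"
    let ?r = "norm x"
    have eq: "euler (\<lambda>x. u x * u x) x = 2 * (u x * euler u x)"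
      by (simp add: field_deriv_mult supported_smooth u)
    have W0: "0 \<le> W ?r * ?r\<^sup>2" using x W(3) by simp
    have "0 \<le> (W ?r * ?r\<^sup>2) * (euler u x + a * u x)\<^sup>2" using W0 by simp
    then have 1: "0 \<le> (W ?r * ?r\<^sup>2) * (euler u x * euler u x) + (W ?r * ?r\<^sup>2) * (2 * a * (u x * euler u x))
        + (W ?r * ?r\<^sup>2) * (a\<^sup>2 * (u x * u x))"
      by (simp add: algebra_simps power2_eq_square)
    have "a * ?r\<^sup>2 * (- lam * W ?r) \<le> a * ?r\<^sup>2 * (?r * W' ?r)"
      using x a(2) W(4)[of ?r] by (intro mult_left_mono) auto
    then have "0 \<le> a * ?r\<^sup>2 * (?r * W' ?r) + lam * (a * ?r\<^sup>2 * W ?r)" by (simp add: algebra_simps)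
    moreover have "lam = ?n - 2 - 2 * a" using a(1) by simp
    ultimately have "2 * a\<^sup>2 * (W ?r * ?r\<^sup>2) \<le> - (?r * ?k' ?r + (?n - 4) * ?k ?r)"
      by (simp add: algebra_simps power2_eq_square)
    then have "2 * a\<^sup>2 * (W ?r * ?r\<^sup>2) * (u x * u x) \<le> - (?r * ?k' ?r + (?n - 4) * ?k ?r) * (u x * u x)"
      by (rule mult_right_mono) simp
    then have "(W ?r * ?r\<^sup>2) * (a\<^sup>2 * (u x * u x)) + (W ?r * ?r\<^sup>2) * (a\<^sup>2 * (u x * u x))
        + (?r * ?k' ?r + (?n - 4) * ?k ?r) * (u x * u x) \<le> 0"
      by (simp add: algebra_simps)
    with 1 show "(W ?r * ?r\<^sup>2) * (a\<^sup>2 * (u x * u x)) + (?k ?r * euler (\<lambda>x. u x * u x) x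
        + (?r * ?k' ?r + (?n - 4) * ?k ?r) * (u x * u x)) \<le> (W ?r * ?r\<^sup>2) * (euler u x * euler u x)"
      unfolding eq by (simp add: algebra_simps)
  qed
  \<comment> \<open>The coefficient \<open>?k\<close> is nonpositive and \<open>cut_error\<close>
    nonnegative, so this error can be discarded without taking a limit.\<close>
  moreover have "0 \<le> - (\<integral>x. cut_error \<epsilon> (norm x) * (?k (norm x) * (u x * u x)) \<partial>lborel)"
  proof -
    have "0 \<le> (\<integral>x. cut_error \<epsilon> (norm x) * (- ?k (norm x) * (u x * u x)) \<partial>lborel)"
    proof (rule integral_nonneg_AE, intro always_eventually allI)
      fix x :: 'a
      show "0 \<le> cut_error \<epsilon> (norm x) * (- ?k (norm x) * (u x * u x))"
      proof (cases "x = 0 \<or> R \<le> norm x")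
        case True
        then have "cut_error \<epsilon> (norm x) = 0 \<or> x \<notin> S"
          using eps_pos S_subset by (auto simp: cut_error_eq_0)
        then show ?thesis using supported_eq_0[OF u, of x] by auto
      next
        case False
        then show ?thesis
          using a(2) W(3)[of "norm x"]
          by (intro mult_nonneg_nonneg[OF cut_error_nonneg[OF eps_pos]] mult_nonneg_nonneg[OF _ zero_le_square]) auto
      qed
    qed
    then show ?thesis by simp
  qed
  moreover have "(\<integral>x. cut_weight \<epsilon> (norm x) * ((W (norm x) * (norm x)\<^sup>2) * (a\<^sup>2 * (u x * u x))) \<partial>lborel)
    = a\<^sup>2 * (\<integral>x. cut_weight \<epsilon> (norm x) * ((W (norm x) * (norm x)\<^sup>2) * (u x * u x)) \<partial>lborel)"
    by (subst integral_mult_right_zero[symmetric]) (simp add: mult_ac)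
  ultimately show ?thesis by linarith
qed

text \<open>A rotation sees neither the radial weight nor the cutoff: with \<open>\<mu> = 0\<close>
  and trace zero, the divergence theorem leaves just this term.\<close>

lemma rot_integral_eq_0:
  assumes "supported h"
  shows "(\<integral>x. cut_weight \<epsilon> (norm x) * field_deriv (rot a b) h x \<partial>lborel) = 0"
proof -
  have "(\<integral>x. cut_weight \<epsilon> (norm x) * field_deriv (rot a b) h x
    + (0 * norm x * ((cut_error \<epsilon> (norm x) - 4 * cut_weight \<epsilon> (norm x)) / norm x) + (\<Sum>c\<in>Basis. rot a b c \<bullet> c) * cut_weight \<epsilon> (norm x)) * h x \<partial>lborel) = 0"
  proof (rule radial_field_integral[OF compact_S S_subset supported_smooth[OF assms] supported_eq_0[OF assms] eps_pos,
      where A = "rot a b" and \<mu> = 0 and \<psi> = "cut_weight \<epsilon>" and \<psi>' = "\<lambda>r. (cut_error \<epsilon> r - 4 * cut_weight \<epsilon> r) / r"])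
    show "continuous_on {0<..<R} (\<lambda>r. (cut_error \<epsilon> r - 4 * cut_weight \<epsilon> r) / r)"
      by (intro continuous_intros continuous_on_cut_weight continuous_on_cut_error) auto
  qed (auto simp: cut_weight_eq_0[OF eps_pos] cut_error_eq_0[OF eps_pos] linear_rot inner_rot_self
      intro!: has_real_derivative_cut_weight eps_pos)
  then show ?thesis by (simp add: trace_rot)
qed

text \<open>With \<open>b = r\<^sup>2 (u\<^sub>r\<^sub>r + (n - 1) u\<^sub>r / r)\<close> the radial part of \<open>r\<^sup>2 \<Delta>u\<close> and \<open>v\<close> a rotational derivative
  of \<open>u\<close>, this is the nonnegativity of the mixed term between radial and angular parts.\<close>

lemma mixed_term_ge:
  fixes u :: "'a \<Rightarrow> real" and c d :: 'a
  assumes u: "supported u" and n: "4 \<le> DIM('a)"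
  defines "b \<equiv> \<lambda>x. euler (euler u) x + (real DIM('a) - 2) * euler u x"
    and "v \<equiv> field_deriv (rot c d) u"
  shows "(\<integral>x. cut_error \<epsilon> (norm x) * (1 * (v x * euler v x + v x * v x)) \<partial>lborel)
    \<le> (\<integral>x. cut_weight \<epsilon> (norm x) * (b x * field_deriv (rot c d) v x) \<partial>lborel)"
proof -
  let ?n = "real DIM('a)" and ?L = "field_deriv (rot c d)"
  have v: "supported v" unfolding v_def by (intro supported_field_deriv linear_rot u)
  have b: "supported b"
    unfolding b_def by (intro supported_add supported_cmult supported_field_deriv linear_ident u)
  have Ev: "supported (euler v)" by (intro supported_field_deriv linear_ident v)
  have bv: "supported (\<lambda>x. b x * v x)" by (intro supported_mult b v)
  \<comment> \<open>This choice lets the divergence of the radial field with coefficient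
    \<open>- h\<close> cancel the terms \<open>v E E v\<close> and \<open>v E v\<close> that arise
    when one rotation is moved from \<open>v\<close> to \<open>b\<close> (with E the Euler
    derivative).\<close>
  define h where "h x = v x * euler v x + v x * v x" for x
  have h: "supported h" unfolding h_def by (intro supported_add supported_mult v Ev)
  \<comment> \<open>Rotations commute with the Euler field, so the rotated radial part of
    \<open>u\<close> is the radial part of \<open>v\<close>.\<close>
  have Lb: "?L b x = euler (euler v) x + (?n - 2) * euler v x" for x
  proof -
    have "smooth (euler u)" "smooth (euler (euler u))"
      by (intro supported_smooth supported_field_deriv linear_ident u)+
    then have "?L b x = ?L (euler (euler u)) x + (?n - 2) * ?L (euler u) x"
      unfolding b_def by (simp add: field_deriv_add field_deriv_cmult smooth_mult smooth_const)
    then show ?thesis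
      using supported_smooth[OF u] supported_smooth[OF supported_field_deriv[OF linear_ident u]]
      by (simp add: euler_rot_commute[symmetric] v_def)
  qed
  have Eh: "euler h x = (euler v x)\<^sup>2 + v x * euler (euler v) x + 2 * (v x * euler v x)" for x
    unfolding h_def using supported_smooth[OF v] supported_smooth[OF Ev]
    by (simp add: field_deriv_add field_deriv_mult smooth_mult power2_eq_square)
  have Lbv: "?L (\<lambda>x. b x * v x) x = b x * ?L v x + ?L b x * v x" for x
    using supported_smooth[OF v] supported_smooth[OF b] by (rule field_deriv_mult[rotated])
  have "(\<integral>x. cut_weight \<epsilon> (norm x) * (b x * ?L v x - ?L (\<lambda>x. b x * v x) x) \<partial>lborel)
    = (\<integral>x. cut_weight \<epsilon> (norm x) * (b x * ?L v x) \<partial>lborel)"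
    unfolding right_diff_distrib
    using rot_integral_eq_0[OF bv, of c d]
    by (subst Bochner_Integration.integral_diff)
      (auto intro!: integrable_cut_weight1 supported_mult supported_field_deriv linear_rot b v)
  moreover have F: "supported (\<lambda>x. b x * ?L v x + - 1 * ?L (\<lambda>x. b x * v x) x)"
    by (intro supported_add supported_mult[OF b] supported_cmult supported_field_deriv linear_rot v bv)
  have "(\<integral>x. cut_weight \<epsilon> (norm x) * (0 * h x) \<partial>lborel)
      - (\<integral>x. cut_error \<epsilon> (norm x) * (- 1 * h x) \<partial>lborel)
    \<le> (\<integral>x. cut_weight \<epsilon> (norm x) * (1 * (b x * ?L v x + - 1 * ?L (\<lambda>x. b x * v x) x)) \<partial>lborel)"
  proof (rule euler_integral_le[OF h DERIV_const continuous_on_const continuous_on_const F continuous_on_const h])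
    fix x :: 'a
    \<comment> \<open>This is exactly what remains after the cancellations, and it is nonnegative
      from dimension 4 on.\<close>
    have "0 \<le> (?n - 4) * (v x)\<^sup>2 + (euler v x)\<^sup>2" using n by simp
    then show "0 * h x + (- 1 * euler h x + (norm x * 0 + (?n - 4) * - 1) * h x)
      \<le> 1 * (b x * ?L v x + - 1 * ?L (\<lambda>x. b x * v x) x)"
      unfolding Lbv Lb Eh by (simp add: h_def algebra_simps power2_eq_square)
  qed
  ultimately have "(\<integral>x. cut_error \<epsilon> (norm x) * (1 * h x) \<partial>lborel)
    \<le> (\<integral>x. cut_weight \<epsilon> (norm x) * (b x * ?L v x) \<partial>lborel)" by simp
  then show ?thesis by (simp only: h_def)
qed

text \<open>Squaring radial part plus half of the angular part \<open>\<Lambda>\<close> gives the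
  square of \<open>b\<close>, the mixed product and a quarter of the square of
  \<open>\<Lambda>\<close>. The last is dropped, and the mixed product is handled one rotation at a
  time.\<close>

lemma laplacian_integral_ge:
  fixes u :: "'a \<Rightarrow> real"
  assumes u: "supported u" and n: "4 \<le> DIM('a)"
  defines "b \<equiv> \<lambda>x. euler (euler u) x + (real DIM('a) - 2) * euler u x"
    and "h \<equiv> \<lambda>c d x. field_deriv (rot c d) u x * euler (field_deriv (rot c d) u) x
      + field_deriv (rot c d) u x * field_deriv (rot c d) u x"
  shows "(\<integral>x. cut_weight \<epsilon> (norm x) * (b x * b x) \<partial>lborel)
      + (\<Sum>c\<in>Basis. \<Sum>d\<in>Basis. \<integral>x. cut_error \<epsilon> (norm x) * (1 * h c d x) \<partial>lborel)
    \<le> (\<integral>x. cut_weight \<epsilon> (norm x) * ((norm x)\<^sup>2 * laplacian u x)\<^sup>2 \<partial>lborel)"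
proof -
  let ?L2 = "\<lambda>c d. field_deriv (rot c d) (field_deriv (rot c d) u)"
  define \<Lambda> where "\<Lambda> x = (\<Sum>c\<in>Basis. \<Sum>d\<in>Basis. ?L2 c d x)" for x
  have b: "supported b"
    unfolding b_def by (intro supported_add supported_cmult supported_field_deriv linear_ident u)
  have L2: "supported (?L2 c d)" for c d
    by (intro supported_field_deriv linear_rot u)
  have \<Lambda>: "supported \<Lambda>" unfolding \<Lambda>_def by (intro supported_sum L2)
  have lap: "((norm x)\<^sup>2 * laplacian u x)\<^sup>2 = (b x + 1 / 2 * \<Lambda> x) * (b x + 1 / 2 * \<Lambda> x)" for x
    using laplacian_euler_rot[OF supported_smooth[OF u], of x]
    by (simp add: b_def \<Lambda>_def power2_eq_square)
  have "(\<integral>x. cut_weight \<epsilon> (norm x) * (b x * \<Lambda> x) \<partial>lborel)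
    = (\<integral>x. (\<Sum>c\<in>Basis. \<Sum>d\<in>Basis. cut_weight \<epsilon> (norm x) * (b x * ?L2 c d x)) \<partial>lborel)"
    by (simp add: \<Lambda>_def sum_distrib_left)
  also have "\<dots> = (\<Sum>c\<in>Basis. \<Sum>d\<in>Basis. \<integral>x. cut_weight \<epsilon> (norm x) * (b x * ?L2 c d x) \<partial>lborel)"
    by (simp add: Bochner_Integration.integral_sum integrable_cut_weight1 supported_mult b L2)
  also have "(\<Sum>c\<in>Basis. \<Sum>d\<in>Basis. \<integral>x. cut_error \<epsilon> (norm x) * (1 * h c d x) \<partial>lborel) \<le> \<dots>"
    unfolding h_def b_def by (intro sum_mono mixed_term_ge u n)
  finally have "(\<Sum>c\<in>Basis. \<Sum>d\<in>Basis. \<integral>x. cut_error \<epsilon> (norm x) * (1 * h c d x) \<partial>lborel)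
    \<le> (\<integral>x. cut_weight \<epsilon> (norm x) * (b x * \<Lambda> x) \<partial>lborel)" .
  moreover have "(\<integral>x. cut_weight \<epsilon> (norm x) * (b x * b x) \<partial>lborel) + (\<integral>x. cut_weight \<epsilon> (norm x) * (b x * \<Lambda> x) \<partial>lborel)
    = (\<integral>x. cut_weight \<epsilon> (norm x) * (b x * b x) + cut_weight \<epsilon> (norm x) * (b x * \<Lambda> x) \<partial>lborel)"
    by (intro Bochner_Integration.integral_add[symmetric] integrable_cut_weight1 supported_mult b \<Lambda>)
  moreover have "\<dots> \<le> (\<integral>x. cut_weight \<epsilon> (norm x) * ((norm x)\<^sup>2 * laplacian u x)\<^sup>2 \<partial>lborel)"
  proof (rule integral_mono)
    show "integrable lborel (\<lambda>x. cut_weight \<epsilon> (norm x) * (b x * b x) + cut_weight \<epsilon> (norm x) * (b x * \<Lambda> x))"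
      by (intro Bochner_Integration.integrable_add integrable_cut_weight1 supported_mult b \<Lambda>)
    show "integrable lborel (\<lambda>x. cut_weight \<epsilon> (norm x) * ((norm x)\<^sup>2 * laplacian u x)\<^sup>2)"
      unfolding lap by (intro integrable_cut_weight1 supported_mult supported_add supported_cmult b \<Lambda>)
    fix x :: 'a
    have "0 \<le> (\<Lambda> x)\<^sup>2 / 4" by simp
    then have "b x * b x + b x * \<Lambda> x \<le> ((norm x)\<^sup>2 * laplacian u x)\<^sup>2"
      unfolding lap by (simp add: algebra_simps power2_eq_square)
    then show "cut_weight \<epsilon> (norm x) * (b x * b x) + cut_weight \<epsilon> (norm x) * (b x * \<Lambda> x)
      \<le> cut_weight \<epsilon> (norm x) * ((norm x)\<^sup>2 * laplacian u x)\<^sup>2"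
      unfolding distrib_left[symmetric] by (rule mult_left_mono[OF _ cut_weight_nonneg])
  qed
  ultimately show ?thesis by linarith
qed

end

section \<open>The Riccati equation of a Bessel potential\<close>

text \<open>With \<open>q = r y' / y\<close> the equation of a Bessel potential becomes a Riccati equation. Since
  \<open>r q' \<le> - q\<^sup>2\<close>, a positive value of \<open>q\<close> would blow up at a positive radius to the left.\<close>

lemma bessel_riccati:
  assumes y: "positive_solution W R c y" and c: "0 < c" and R: "0 < R"
    and W: "continuous_on {0<..<R} W" "\<And>r. r \<in> {0<..<R} \<Longrightarrow> 0 \<le> W r"
  obtains q q' :: "real \<Rightarrow> real" and B where
    "\<And>r. r \<in> {0<..<R} \<Longrightarrow> (q has_real_derivative q' r) (at r)"
    "continuous_on {0<..<R} q'"
    "\<And>r. r \<in> {0<..<R} \<Longrightarrow> r * q' r + (q r)\<^sup>2 = - c * (W r * r\<^sup>2)"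
    "\<And>r. r \<in> {0<..<R} \<Longrightarrow> q r \<le> 0"
    "\<And>r. 0 < r \<Longrightarrow> r \<le> R / 2 \<Longrightarrow> \<bar>q r\<bar> \<le> B"
proof -
  obtain y' y'' where yy: "\<And>r. r \<in> {0<..<R} \<Longrightarrow> 0 < y r"
      "\<And>r. r \<in> {0<..<R} \<Longrightarrow> (y has_real_derivative y' r) (at r)"
      "\<And>r. r \<in> {0<..<R} \<Longrightarrow> (y' has_real_derivative y'' r) (at r)"
      "\<And>r. r \<in> {0<..<R} \<Longrightarrow> y'' r + 1 / r * y' r + c * W r * y r = 0"
    using y unfolding positive_solution_def by blast
  define q where "q r = r * y' r / y r" for r
  \<comment> \<open>Solving the Riccati equation for the derivative, instead of differentiating the
    quotient, makes continuity of \<open>q'\<close> follow from that of \<open>W\<close> and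
    \<open>q\<close>.\<close>
  define q' where "q' r = - (c * (W r * r) + (q r)\<^sup>2 / r)" for r
  have dq: "(q has_real_derivative q' r) (at r)" if r: "r \<in> {0<..<R}" for r
  proof -
    have y0: "y r \<noteq> 0" "r \<noteq> 0" using yy(1)[OF r] r by auto
    have "(q has_real_derivative ((y' r + r * y'' r) * y r - r * y' r * y' r) / (y r * y r)) (at r)"
      unfolding q_def[abs_def] using y0
      by (auto intro!: derivative_eq_intros yy(2,3)[OF r] simp: algebra_simps)
    moreover have eq: "y'' r = - (1 / r * y' r) - c * W r * y r" using yy(4)[OF r] by linarith
    have "((y' r + r * y'' r) * y r - r * y' r * y' r) / (y r * y r) = q' r"
      unfolding q'_def q_def eq using y0 by (simp add: field_simps power2_eq_square)
    ultimately show ?thesis by simp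
  qed
  have cq: "continuous_on {0<..<R} q"
    by (rule continuous_at_imp_continuous_on) (auto intro: DERIV_isCont dq)
  have cq': "continuous_on {0<..<R} q'"
    unfolding q'_def[abs_def] by (intro continuous_intros W cq) auto
  have ric: "r * q' r + (q r)\<^sup>2 = - c * (W r * r\<^sup>2)" if "r \<in> {0<..<R}" for r
    using that by (simp add: q'_def field_simps power2_eq_square)
  have q'_le: "q' r \<le> 0" if "r \<in> {0<..<R}" for r
  proof -
    have "0 \<le> c * (W r * r)" "0 \<le> (q r)\<^sup>2 / r" using that W(2)[OF that] c by simp_all
    then show ?thesis unfolding q'_def by linarith
  qed
  have mono: "q s \<le> q r" if "0 < r" "r \<le> s" "s < R" for r s
  proof (rule DERIV_nonpos_imp_nonincreasing[OF that(2)])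
    fix x assume "r \<le> x" "x \<le> s"
    then have "x \<in> {0<..<R}" using that by auto
    then show "\<exists>z. (q has_real_derivative z) (at x) \<and> z \<le> 0" using dq q'_le by blast
  qed
  have nonpos: "q s \<le> 0" if s: "s \<in> {0<..<R}" for s
  proof (rule ccontr)
    assume "\<not> q s \<le> 0"
    then have qs: "0 < q s" by simp
    \<comment> \<open>The radius at which the comparison below pushes \<open>1 / q r\<close> down to
      zero, while \<open>q r\<close> is still positive.\<close>
    define r where "r = s * exp (- 1 / q s)"
    have r: "0 < r" "r < s" using s qs by (auto simp: r_def)
    have pos: "0 < q x" if "r \<le> x" "x \<le> s" for x
      using mono[of x s] that r s qs by auto
    \<comment> \<open>The derivative of \<open>1 / q\<close> is \<open>1 / x\<close> plus a
      nonnegative potential term, so subtracting the logarithm leaves a nondecreasing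
      function.\<close>
    have "1 / q r - ln r \<le> 1 / q s - ln s"
    proof (rule DERIV_nonneg_imp_nondecreasing[where f = "\<lambda>r. 1 / q r - ln r"])
      show "r \<le> s" using r by simp
      fix x assume x: "r \<le> x" "x \<le> s"
      then have xR: "x \<in> {0<..<R}" using r s by auto
      have qx: "0 < q x" using pos[OF x] .
      have "((\<lambda>r. 1 / q r - ln r) has_real_derivative - q' x / (q x)\<^sup>2 - 1 / x) (at x)"
        using qx xR by (auto intro!: derivative_eq_intros dq[OF xR] simp: power2_eq_square)
      moreover have "- q' x / (q x)\<^sup>2 - 1 / x = c * (W x * x) / (q x)\<^sup>2"
        using qx xR by (simp add: q'_def field_simps)
      moreover have "0 \<le> c * (W x * x) / (q x)\<^sup>2" using c W(2)[OF xR] xR by simp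
      ultimately show "\<exists>z. ((\<lambda>r. 1 / q r - ln r) has_real_derivative z) (at x) \<and> 0 \<le> z" by auto
    qed
    moreover have "ln r = ln s - 1 / q s"
      using s by (simp add: r_def ln_mult)
    ultimately have "1 / q r \<le> 0" by simp
    then show False using pos[of r] r by (simp add: divide_le_0_iff)
  qed
  \<comment> \<open>A nonincreasing, nonpositive \<open>q\<close> is largest in absolute value at
    the right end of the interval, hence bounded near 0.\<close>
  have "\<bar>q r\<bar> \<le> - q (R / 2)" if "0 < r" "r \<le> R / 2" for r
    using mono[of r "R / 2"] nonpos[of r] that R by auto
  with dq cq' ric nonpos show thesis by (rule that)
qed

section \<open>Vanishing of the cutoff errors\<close>

lemma field_deriv_bound:
  assumes A: "linear A" and u: "smooth u" and S: "compact S" "\<And>x. x \<notin> S \<Longrightarrow> u x = 0"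
  obtains C where "\<And>x. \<bar>field_deriv A u x\<bar> \<le> C * norm x"
proof -
  have "\<exists>M. \<forall>x. \<bar>partial_deriv b u x\<bar> \<le> M" if b: "b \<in> Basis" for b
  proof -
    have "bounded (partial_deriv b u ` S)"
      using smooth_continuous[OF smooth_partial_deriv[OF u b]] S(1)
      by (intro compact_imp_bounded compact_continuous_image) auto
    then obtain M where M: "\<And>x. x \<in> S \<Longrightarrow> \<bar>partial_deriv b u x\<bar> \<le> M" by (auto simp: bounded_iff)
    have "\<bar>partial_deriv b u x\<bar> \<le> max M 0" for x
      using M[of x] field_deriv_eq_0[OF u compact_imp_closed[OF S(1)] S(2), of x "\<lambda>_. b"]
      by (cases "x \<in> S") (auto simp: field_deriv_def partial_deriv_def)
    then show ?thesis by blast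
  qed
  then obtain M where M: "\<And>b x. b \<in> Basis \<Longrightarrow> \<bar>partial_deriv b u x\<bar> \<le> M b" by metis
  obtain K where K: "\<And>x. norm (A x) \<le> norm x * K"
    using bounded_linear.bounded[of A] A by (auto simp: linear_linear)
  \<comment> \<open>A linear field vanishes to first order at the origin; this gives the factor
    \<open>norm x\<close>, and a product of two such derivatives gains its square.\<close>
  have "\<bar>field_deriv A u x\<bar> \<le> (\<Sum>b\<in>Basis. K * M b) * norm x" for x
  proof -
    have "\<bar>field_deriv A u x\<bar> \<le> (\<Sum>b\<in>Basis. \<bar>(A x \<bullet> b) * partial_deriv b u x\<bar>)"
      unfolding field_deriv_eq_sum[OF u] by (rule sum_abs)
    also have "\<dots> \<le> (\<Sum>b\<in>Basis. (norm x * K) * M b)"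
      unfolding abs_mult
      by (intro sum_mono mult_mono M order_trans[OF Basis_le_norm K] order_trans[OF norm_ge_zero K]) auto
    also have "\<dots> = (\<Sum>b\<in>Basis. K * M b) * norm x" by (subst sum_distrib_right) (simp add: mult_ac)
    finally show ?thesis .
  qed
  then show thesis by (rule that)
qed

text \<open>The quadratic bound on \<open>h\<close> makes the integrand of order
  \<open>1 / \<epsilon>\<^sup>2\<close> on a ball of radius \<open>2 * \<epsilon>\<close>. With the
  volume of that ball the integral is of order \<open>\<epsilon> ^ (DIM('a) - 2)\<close>, and the
  exponent is positive.\<close>

lemma cut_error_integral_tendsto_0:
  fixes h :: "'a::euclidean_space \<Rightarrow> real"
  assumes S: "compact S" "S \<subseteq> ball 0 R" and n: "3 \<le> DIM('a)"
    and k: "continuous_on {0<..<R} k" "0 < \<rho>" "\<And>r. 0 < r \<Longrightarrow> r \<le> \<rho> \<Longrightarrow> \<bar>k r\<bar> \<le> B"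
    and h: "radial_cutoff.supported S h" "\<And>x. \<bar>h x\<bar> \<le> C * (norm x)\<^sup>2"
  shows "((\<lambda>\<epsilon>. \<integral>x. cut_error \<epsilon> (norm x) * (k (norm x) * h x) \<partial>lborel) \<longlongrightarrow> 0) (at_right 0)"
proof (rule Lim_null_comparison)
  let ?V = "unit_ball_vol (real DIM('a))"
  let ?M = "B * C * 8 * ?V * 2 ^ DIM('a)"
  show "((\<lambda>\<epsilon>. ?M * \<epsilon> ^ (DIM('a) - 2)) \<longlongrightarrow> 0) (at_right 0)"
  proof -
    have z: "(0::real) ^ (DIM('a) - 2) = 0" using n by (simp add: power_0_left)
    have "((\<lambda>\<epsilon>. ?M * \<epsilon> ^ (DIM('a) - 2)) \<longlongrightarrow> ?M * 0 ^ (DIM('a) - 2)) (at_right 0)"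
      by (intro tendsto_intros)
    then show ?thesis by (simp only: z mult_zero_right)
  qed
  have "eventually (\<lambda>\<epsilon>. 0 < \<epsilon> \<and> 2 * \<epsilon> \<le> \<rho>) (at_right 0)"
    using k(2) by (intro eventually_conj eventually_at_right_less)
      (auto simp: eventually_at_right_field intro!: exI[of _ "\<rho> / 2"])
  then show "eventually (\<lambda>\<epsilon>. norm (\<integral>x. cut_error \<epsilon> (norm x) * (k (norm x) * h x) \<partial>lborel)
      \<le> ?M * \<epsilon> ^ (DIM('a) - 2)) (at_right 0)"
  proof (rule eventually_mono)
    fix \<epsilon> assume "0 < \<epsilon> \<and> 2 * \<epsilon> \<le> \<rho>"
    then have \<epsilon>: "0 < \<epsilon>" "2 * \<epsilon> \<le> \<rho>" by auto
    interpret radial_cutoff R \<epsilon> S using \<epsilon>(1) S by unfold_locales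
    have d: "2 + (DIM('a) - 2) = DIM('a)" using n by simp
    have B: "0 \<le> B" using k(3)[of \<rho>] k(2) by auto
    have "norm (\<integral>x. cut_error \<epsilon> (norm x) * (k (norm x) * h x) \<partial>lborel)
      \<le> (\<integral>x. indicator (cball 0 (2 * \<epsilon>)) x *\<^sub>R (B * C * (8 / \<epsilon>\<^sup>2)) \<partial>(lborel :: 'a measure))"
    proof (rule Bochner_Integration.integral_norm_bound_integral)
      show "integrable lborel (\<lambda>x. cut_error \<epsilon> (norm x) * (k (norm x) * h x))"
        by (rule integrable_cut_error[OF k(1) h(1)])
      show "integrable lborel (\<lambda>x::'a. indicator (cball 0 (2 * \<epsilon>)) x *\<^sub>R (B * C * (8 / \<epsilon>\<^sup>2)))"
        by (intro borel_integrable_compact) auto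
      fix x :: 'a
      show "norm (cut_error \<epsilon> (norm x) * (k (norm x) * h x))
        \<le> indicator (cball 0 (2 * \<epsilon>)) x *\<^sub>R (B * C * (8 / \<epsilon>\<^sup>2))"
      proof (cases "x \<in> cball 0 (2 * \<epsilon>)")
        case False
        then show ?thesis using cut_error_bound(2)[OF \<epsilon>(1), of "norm x"] by simp
      next
        case True
        show ?thesis
        proof (cases "x = 0")
          case True
          \<comment> \<open>At the origin the bound on \<open>h\<close> says nothing about
            \<open>C\<close>; its sign is read off at a basis vector, which has norm 1.\<close>
          then have "0 \<le> C"
            using h(2)[of "SOME b. b \<in> Basis"] someI_ex[of "\<lambda>b::'a. b \<in> Basis"] nonempty_Basis
            by (auto simp: norm_Basis ex_in_conv)
          then show ?thesis using True B \<epsilon> cut_error_eq_0[OF \<epsilon>(1), of 0] by simp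
        next
          case x: False
          have kB: "\<bar>k (norm x)\<bar> \<le> B" using True x \<epsilon> by (intro k(3)) auto
          have C: "0 \<le> C" using order_trans[OF abs_ge_zero h(2)[of x]] x by (simp add: zero_le_mult_iff)
          have "norm (cut_error \<epsilon> (norm x) * (k (norm x) * h x)) = cut_error \<epsilon> (norm x) * (\<bar>k (norm x)\<bar> * \<bar>h x\<bar>)"
            using cut_error_nonneg[OF \<epsilon>(1)] by (simp add: abs_mult)
          also have "\<dots> \<le> cut_error \<epsilon> (norm x) * (B * (C * (norm x)\<^sup>2))"
            using cut_error_nonneg[OF \<epsilon>(1)] by (intro mult_left_mono mult_mono kB h B) auto
          also have "\<dots> = B * C * ((norm x)\<^sup>2 * cut_error \<epsilon> (norm x))" by simp
          also have "\<dots> \<le> B * C * (8 / \<epsilon>\<^sup>2)"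
            using cut_error_bound(1)[OF \<epsilon>(1)] B C by (intro mult_left_mono) auto
          finally show ?thesis using True by simp
        qed
      qed
    qed
    also have "\<dots> = measure lborel (cball (0::'a) (2 * \<epsilon>)) * (B * C * (8 / \<epsilon>\<^sup>2))"
      by simp
    also have "\<dots> = ?V * (2 * \<epsilon>) ^ DIM('a) * (B * C * (8 / \<epsilon>\<^sup>2))"
      using \<epsilon> content_cball[of "2 * \<epsilon>" "0::'a"] by simp
    also have "(2 * \<epsilon>) ^ DIM('a) = 2 ^ DIM('a) * (\<epsilon>\<^sup>2 * \<epsilon> ^ (DIM('a) - 2))"
      by (simp only: power_mult_distrib power_add[symmetric] d)
    also have "?V * (2 ^ DIM('a) * (\<epsilon>\<^sup>2 * \<epsilon> ^ (DIM('a) - 2))) * (B * C * (8 / \<epsilon>\<^sup>2)) = ?M * \<epsilon> ^ (DIM('a) - 2)"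
      using \<epsilon> by simp
    finally show "norm (\<integral>x. cut_error \<epsilon> (norm x) * (k (norm x) * h x) \<partial>lborel) \<le> ?M * \<epsilon> ^ (DIM('a) - 2)" .
  qed
qed

section \<open>The Hardy--Rellich inequality\<close>

text \<open>Chains the bounds from the Laplacian to the radial part, from there to \<open>w\<close>,
  and from \<open>w\<close> to \<open>u\<close>. Errors in the square of \<open>u\<close> are
  discarded by sign; those in first derivatives along the fields, and in \<open>euler\<close> of the
  rotational ones, stay on the right for the limit.\<close>

lemma hardy_rellich_cutoff:
  fixes u :: "'a::euclidean_space \<Rightarrow> real"
  assumes rc: "radial_cutoff R \<epsilon> S" and u: "radial_cutoff.supported S u" and n: "4 \<le> DIM('a)"
    and q: "\<And>r. r \<in> {0<..<R} \<Longrightarrow> (q has_real_derivative q' r) (at r)" "continuous_on {0<..<R} q'"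
      "\<And>r. r \<in> {0<..<R} \<Longrightarrow> r * q' r + (q r)\<^sup>2 = - c * (W r * r\<^sup>2)"
      "\<And>r. r \<in> {0<..<R} \<Longrightarrow> q r \<le> 0"
    and c: "0 \<le> c"
    and W: "\<And>r. r \<in> {0<..<R} \<Longrightarrow> (W has_real_derivative W' r) (at r)" "continuous_on {0<..<R} W'"
      "\<And>r. r \<in> {0<..<R} \<Longrightarrow> 0 \<le> W r"
      "\<And>r. r \<in> {0<..<R} \<Longrightarrow> - lam * W r \<le> r * W' r"
    and lam: "lam \<le> real DIM('a) - 2"
  defines "n \<equiv> real DIM('a)"
    and "w \<equiv> euler u"
    and "v \<equiv> \<lambda>c d. field_deriv (rot c d) u"
  shows "(\<integral>x. cut_weight \<epsilon> (norm x) * ((n\<^sup>2 * (n - 4)\<^sup>2 / 16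
        + (n\<^sup>2 / 4 + (n - lam - 2)\<^sup>2 / 4) * c * (W (norm x) * (norm x)\<^sup>2)) * (u x * u x)) \<partial>lborel)
    \<le> (\<integral>x. cut_weight \<epsilon> (norm x) * ((norm x)\<^sup>2 * laplacian u x)\<^sup>2 \<partial>lborel)
      + (\<integral>x. cut_error \<epsilon> (norm x) * ((n / 2 + q (norm x)) * (w x * w x)) \<partial>lborel)
      - (\<Sum>a\<in>Basis. \<Sum>b\<in>Basis. \<integral>x. cut_error \<epsilon> (norm x) * (1 * (v a b x * euler (v a b) x + v a b x * v a b x)) \<partial>lborel)"
proof -
  interpret radial_cutoff R \<epsilon> S by (rule rc)
  have w: "supported w" unfolding w_def by (intro supported_field_deriv linear_ident u)
  have uu: "supported (\<lambda>x. u x * u x)" and ww: "supported (\<lambda>x. w x * w x)"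
    by (intro supported_mult u w)+
  define a where "a = (n - lam - 2) / 2"
  have a: "0 \<le> a" using lam by (simp add: a_def n_def)
  \<comment> \<open>The constant is the minimiser of p^2 + (n - 4)p; completing the square there
    removes all terms linear in \<open>q\<close>. It leaves (n - 4)^2/4 in the Hardy bound and (n -
    4)^2/4 + 2(n - 2) = n^2/4 in the radial one.\<close>
  let ?p = "\<lambda>r. - (n - 4) / 2 + q r"
  let ?V = "\<lambda>r. W r * r\<^sup>2"
  let ?err_w = "\<integral>x. cut_error \<epsilon> (norm x) * ((n / 2 + q (norm x)) * (w x * w x)) \<partial>lborel"
  let ?b = "\<lambda>x. euler (euler u) x + (real DIM('a) - 2) * euler u x"
  define I where "I k h = (\<integral>x. cut_weight \<epsilon> (norm x) * (k (norm x) * h x) \<partial>lborel)" for k :: "real \<Rightarrow> real" and h :: "'a \<Rightarrow> real"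
  have Wc: "continuous_on {0<..<R} W"
    by (rule continuous_at_imp_continuous_on) (auto intro: DERIV_isCont W)
  have Vc: "continuous_on {0<..<R} ?V" by (intro continuous_intros Wc)
  have p: "(?p has_real_derivative q' r) (at r)" if "r \<in> {0<..<R}" for r
    using q(1)[OF that] by (auto intro!: derivative_eq_intros)
  have split: "I (\<lambda>r. \<alpha> + \<beta> * ?V r) h = \<alpha> * I (\<lambda>r. 1) h + \<beta> * I ?V h" if h: "supported h" for \<alpha> \<beta> h
  proof -
    have I1: "integrable lborel (\<lambda>x. cut_weight \<epsilon> (norm x) * (1 * h x))"
      by (rule integrable_cut_weight[OF continuous_on_const h])
    have I2: "integrable lborel (\<lambda>x. cut_weight \<epsilon> (norm x) * (?V (norm x) * h x))"
      by (rule integrable_cut_weight[OF Vc h])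
    have "I (\<lambda>r. \<alpha> + \<beta> * ?V r) h
      = (\<integral>x. \<alpha> * (cut_weight \<epsilon> (norm x) * (1 * h x)) + \<beta> * (cut_weight \<epsilon> (norm x) * (?V (norm x) * h x)) \<partial>lborel)"
      unfolding I_def by (intro Bochner_Integration.integral_cong refl) (simp add: algebra_simps)
    also have "\<dots> = \<alpha> * I (\<lambda>r. 1) h + \<beta> * I ?V h"
      unfolding I_def
      by (subst Bochner_Integration.integral_add[OF integrable_mult_right[OF I1] integrable_mult_right[OF I2]])
        (simp only: integral_mult_right_zero)
    finally show ?thesis .
  qed
  have "I (\<lambda>r. n\<^sup>2 / 4 + c * ?V r) (\<lambda>x. w x * w x)
      - (\<integral>x. cut_error \<epsilon> (norm x) * ((?p (norm x) + (real DIM('a) - 2)) * (w x * w x)) \<partial>lborel)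
    \<le> (\<integral>x. cut_weight \<epsilon> (norm x) * (?b x * ?b x) \<partial>lborel)"
    unfolding I_def w_def
  proof (rule radial_rellich_with_potential[OF w[unfolded w_def] p q(2)])
    show "continuous_on {0<..<R} (\<lambda>r. n\<^sup>2 / 4 + c * ?V r)" by (intro continuous_intros Wc)
    fix r assume "r \<in> {0<..<R}"
    from q(3)[OF this] have "r * q' r = - (q r)\<^sup>2 - c * (W r * r\<^sup>2)" by simp
    then show "n\<^sup>2 / 4 + c * ?V r \<le> 2 * (real DIM('a) - 2) - (r * q' r + (?p r)\<^sup>2 + (real DIM('a) - 4) * ?p r)"
      unfolding n_def[symmetric] by (simp add: field_simps power2_eq_square)
  qed
  moreover have p_n: "?p r + (real DIM('a) - 2) = n / 2 + q r" for r
    by (simp add: n_def field_simps)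
  ultimately have B: "I (\<lambda>r. n\<^sup>2 / 4 + c * ?V r) (\<lambda>x. w x * w x) - ?err_w
    \<le> (\<integral>x. cut_weight \<epsilon> (norm x) * (?b x * ?b x) \<partial>lborel)"
    by (simp only: p_n)
  have "I (\<lambda>r. (n - 4)\<^sup>2 / 4 + c * ?V r) (\<lambda>x. u x * u x)
      - (\<integral>x. cut_error \<epsilon> (norm x) * (?p (norm x) * (u x * u x)) \<partial>lborel)
    \<le> (\<integral>x. cut_weight \<epsilon> (norm x) * (w x * w x) \<partial>lborel)"
    unfolding I_def w_def
  proof (rule hardy_with_potential[OF u p q(2)])
    show "continuous_on {0<..<R} (\<lambda>r. (n - 4)\<^sup>2 / 4 + c * ?V r)" by (intro continuous_intros Wc)
    fix r assume "r \<in> {0<..<R}"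
    from q(3)[OF this] have "r * q' r = - (q r)\<^sup>2 - c * (W r * r\<^sup>2)" by simp
    then show "(n - 4)\<^sup>2 / 4 + c * ?V r \<le> - (r * q' r + (?p r)\<^sup>2 + (real DIM('a) - 4) * ?p r)"
      unfolding n_def[symmetric] by (simp add: field_simps power2_eq_square)
  qed
  \<comment> \<open>Here \<open>u\<close> may be nonzero at the origin, and in dimension 4 smallness
    of this error cannot be expected. Its sign decides instead: \<open>?p\<close> is nonpositive
    because \<open>n \<ge> 4\<close> and \<open>q \<le> 0\<close>.\<close>
  moreover have "0 \<le> (\<integral>x. - (cut_error \<epsilon> (norm x) * (?p (norm x) * (u x * u x))) \<partial>lborel)"
  proof (rule integral_nonneg_AE, intro always_eventually allI)
    fix x :: 'a
    have "cut_error \<epsilon> (norm x) * (?p (norm x) * (u x * u x)) \<le> 0"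
    proof (cases "x = 0 \<or> R \<le> norm x")
      case True
      then have "cut_error \<epsilon> (norm x) = 0 \<or> x \<notin> S"
        using eps_pos S_subset by (auto simp: cut_error_eq_0)
      then show ?thesis using supported_eq_0[OF u, of x] by auto
    next
      case False
      then have "q (norm x) \<le> 0" by (intro q(4)) auto
      moreover have "4 \<le> n" using n by (simp add: n_def)
      ultimately have "?p (norm x) \<le> 0" by (intro add_nonpos_nonpos) simp_all
      then show ?thesis
        by (intro mult_nonneg_nonpos cut_error_nonneg eps_pos mult_nonpos_nonneg) auto
    qed
    then show "0 \<le> - (cut_error \<epsilon> (norm x) * (?p (norm x) * (u x * u x)))" by simp
  qed
  ultimately have C: "I (\<lambda>r. (n - 4)\<^sup>2 / 4 + c * ?V r) (\<lambda>x. u x * u x) \<le> I (\<lambda>r. 1) (\<lambda>x. w x * w x)"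
    unfolding I_def integral_minus mult_1_left by linarith
  have D: "a\<^sup>2 * I ?V (\<lambda>x. u x * u x) \<le> I ?V (\<lambda>x. w x * w x)"
    unfolding I_def w_def using a
    by (intro weighted_hardy[OF u W]) (simp_all add: a_def n_def)
  \<comment> \<open>The bound on \<open>w\<close> has a constant part and a potential part. The
    factor \<open>n\<^sup>2 / 4\<close> multiplies the Hardy bound \<open>C\<close>, giving the
    constant of the singular term and one share of the potential; the weighted bound
    \<open>D\<close> gives the share with \<open>a\<^sup>2\<close>.\<close>
  have "I (\<lambda>r. n\<^sup>2 * (n - 4)\<^sup>2 / 16 + (n\<^sup>2 / 4 + a\<^sup>2) * c * ?V r) (\<lambda>x. u x * u x)
    = n\<^sup>2 / 4 * I (\<lambda>r. (n - 4)\<^sup>2 / 4 + c * ?V r) (\<lambda>x. u x * u x) + c * (a\<^sup>2 * I ?V (\<lambda>x. u x * u x))"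
    unfolding split[OF uu] by (simp add: algebra_simps)
  also have "\<dots> \<le> n\<^sup>2 / 4 * I (\<lambda>r. 1) (\<lambda>x. w x * w x) + c * I ?V (\<lambda>x. w x * w x)"
    by (intro add_mono mult_left_mono C D c) simp
  also have "\<dots> = I (\<lambda>r. n\<^sup>2 / 4 + c * ?V r) (\<lambda>x. w x * w x)"
    unfolding split[OF ww] ..
  finally show ?thesis
    using B laplacian_integral_ge[OF u n]
    by (simp add: I_def v_def a_def power_divide)
qed

section \<open>Removal of the cutoff\<close>

lemma laplacian_eq_0:
  assumes u: "smooth u" and S: "closed S" "\<And>x. x \<notin> S \<Longrightarrow> u x = 0" and x: "x \<notin> S"
  shows "laplacian u x = 0"
proof -
  have "partial_deriv b (partial_deriv b u) x = 0" if b: "b \<in> Basis" for b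
  proof -
    have "partial_deriv b u z = 0" if "z \<notin> S" for z
      using field_deriv_eq_0[OF u S that, of "\<lambda>_. b"] by (simp add: field_deriv_def partial_deriv_def)
    then show ?thesis
      using field_deriv_eq_0[OF smooth_partial_deriv[OF u b] S(1) _ x, of "\<lambda>_. b"]
      by (simp add: field_deriv_def partial_deriv_def)
  qed
  then show ?thesis by (simp add: laplacian_def)
qed

text \<open>Let the cutoff scale tend to zero: Fatou's lemma controls the left side, the right side
  never exceeds the full integral, and the errors vanish. Extended nonnegative integrals make a
  prior proof of integrability of the singular terms unnecessary.\<close>

lemma hardy_rellich_admissible:
  fixes u :: "'a::euclidean_space \<Rightarrow> real" and R lam c :: real
  assumes R: "0 < R" and S: "compact S" "S \<subseteq> ball 0 R" and u: "smooth u" "\<And>x. x \<notin> S \<Longrightarrow> u x = 0"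
    and dim: "4 \<le> DIM('a)" and y: "positive_solution W R c y" and c: "0 < c"
    and W: "\<And>r. r \<in> {0<..<R} \<Longrightarrow> (W has_real_derivative W' r) (at r)" "continuous_on {0<..<R} W'"
      "\<And>r. r \<in> {0<..<R} \<Longrightarrow> 0 \<le> W r"
      "\<And>r. r \<in> {0<..<R} \<Longrightarrow> - lam * W r \<le> r * W' r"
    and lam: "lam \<le> real DIM('a) - 2"
  defines "n \<equiv> real DIM('a)"
  shows "(\<integral>\<^sup>+x\<in>ball 0 R. ennreal (n\<^sup>2 * (n - 4)\<^sup>2 / 16 * ((u x)\<^sup>2 / norm x ^ 4)
        + (n\<^sup>2 / 4 + (n - lam - 2)\<^sup>2 / 4) * c * (W (norm x) / (norm x)\<^sup>2 * (u x)\<^sup>2)) \<partial>lborel)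
    \<le> (\<integral>\<^sup>+x\<in>ball 0 R. ennreal ((laplacian u x)\<^sup>2) \<partial>lborel)"
proof -
  have Wc: "continuous_on {0<..<R} W"
    by (rule continuous_at_imp_continuous_on) (auto intro: DERIV_isCont W)
  obtain q q' B where q: "\<And>r. r \<in> {0<..<R} \<Longrightarrow> (q has_real_derivative q' r) (at r)"
      "continuous_on {0<..<R} q'"
      "\<And>r. r \<in> {0<..<R} \<Longrightarrow> r * q' r + (q r)\<^sup>2 = - c * (W r * r\<^sup>2)"
      "\<And>r. r \<in> {0<..<R} \<Longrightarrow> q r \<le> 0"
      "\<And>r. 0 < r \<Longrightarrow> r \<le> R / 2 \<Longrightarrow> \<bar>q r\<bar> \<le> B"
    using bessel_riccati[OF y c R Wc W(3)] by blast
  have qc: "continuous_on {0<..<R} q"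
    by (rule continuous_at_imp_continuous_on) (auto intro: DERIV_isCont q)
  define K where "K = n\<^sup>2 * (n - 4)\<^sup>2 / 16"
  define M where "M = (n\<^sup>2 / 4 + (n - lam - 2)\<^sup>2 / 4) * c"
  have KM: "0 \<le> K" "0 \<le> M" using c by (simp_all add: K_def M_def)
  define k where "k r = K + M * (W r * r\<^sup>2)" for r
  have kc: "continuous_on {0<..<R} k"
    unfolding k_def[abs_def] by (intro continuous_intros Wc)
  have k0: "0 \<le> k r" if "r \<in> {0<..<R}" for r
    using KM W(3)[OF that] by (simp add: k_def)
  define F where "F x = k (norm x) / norm x ^ 4 * (u x * u x)" for x
  define L where "L = (\<integral>\<^sup>+x\<in>ball 0 R. ennreal ((laplacian u x)\<^sup>2) \<partial>lborel)"
  define w where "w = euler u"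
  define v where "v a b = field_deriv (rot a b) u" for a b
  \<comment> \<open>All errors that are not settled by sign; each contains a product of two
    functions that vanish to first order at the origin.\<close>
  define e where "e \<epsilon> = (\<integral>x. cut_error \<epsilon> (norm x) * ((n / 2 + q (norm x)) * (w x * w x)) \<partial>lborel)
      - (\<Sum>a\<in>Basis. \<Sum>b\<in>Basis. \<integral>x. cut_error \<epsilon> (norm x) * (1 * (v a b x * euler (v a b) x + v a b x * v a b x)) \<partial>lborel)"
    for \<epsilon>
  have uS: "radial_cutoff.supported S u"
  proof -
    interpret radial_cutoff R 1 S using S by unfold_locales auto
    show ?thesis using u by (simp add: supported_def)
  qed
  have e0: "(e \<longlongrightarrow> 0) (at_right 0)"
  proof -
    interpret radial_cutoff R 1 S using S by unfold_locales auto
    have w: "supported w" unfolding w_def by (intro supported_field_deriv linear_ident uS)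
    have v: "supported (v a b)" for a b unfolding v_def by (intro supported_field_deriv linear_rot uS)
    have Ev: "supported (euler (v a b))" for a b by (intro supported_field_deriv linear_ident v)
    have "((\<lambda>\<epsilon>. \<integral>x. cut_error \<epsilon> (norm x) * ((n / 2 + q (norm x)) * (w x * w x)) \<partial>lborel) \<longlongrightarrow> 0) (at_right 0)"
    proof -
      obtain C where C: "\<And>x. \<bar>w x\<bar> \<le> C * norm x"
        using field_deriv_bound[OF linear_ident u(1) S(1) u(2)] unfolding w_def by blast
      show ?thesis
      proof (rule cut_error_integral_tendsto_0[OF S, where \<rho> = "R / 2" and B = "n / 2 + B" and C = "C * C"])
        show "\<bar>w x * w x\<bar> \<le> C * C * (norm x)\<^sup>2" for x
          using mult_mono[OF C[of x] C[of x]] order_trans[OF abs_ge_zero C[of x]]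
          by (simp add: abs_mult power2_eq_square mult_ac)
        show "\<bar>n / 2 + q r\<bar> \<le> n / 2 + B" if "0 < r" "r \<le> R / 2" for r
          using q(5)[OF that] by (simp add: n_def abs_le_iff)
      qed (use dim R in \<open>auto intro!: continuous_intros qc supported_mult w\<close>)
    qed
    moreover have "((\<lambda>\<epsilon>. \<integral>x. cut_error \<epsilon> (norm x) * (1 * (v a b x * euler (v a b) x + v a b x * v a b x)) \<partial>lborel) \<longlongrightarrow> 0) (at_right 0)"
      for a b
    proof -
      obtain C where C: "\<And>x. \<bar>v a b x\<bar> \<le> C * norm x"
        using field_deriv_bound[OF linear_rot u(1) S(1) u(2)] unfolding v_def by blast
      obtain D where D: "\<And>x. \<bar>euler (v a b) x\<bar> \<le> D * norm x"
        using field_deriv_bound[OF linear_ident supported_smooth[OF v] S(1) supported_eq_0[OF v]] by blast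
      show ?thesis
      proof (rule cut_error_integral_tendsto_0[OF S, where \<rho> = 1 and B = 1 and C = "C * D + C * C"])
        show "\<bar>v a b x * euler (v a b) x + v a b x * v a b x\<bar> \<le> (C * D + C * C) * (norm x)\<^sup>2" for x
        proof -
          have "\<bar>v a b x\<bar> * \<bar>euler (v a b) x\<bar> \<le> (C * norm x) * (D * norm x)"
            using order_trans[OF abs_ge_zero C[of x]] by (intro mult_mono C D) auto
          moreover have "\<bar>v a b x\<bar> * \<bar>v a b x\<bar> \<le> (C * norm x) * (C * norm x)"
            using order_trans[OF abs_ge_zero C[of x]] by (intro mult_mono C) auto
          ultimately show ?thesis
            using abs_triangle_ineq[of "v a b x * euler (v a b) x" "v a b x * v a b x"]
            by (simp add: abs_mult power2_eq_square algebra_simps)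
        qed
      qed (use dim in \<open>auto intro!: supported_mult supported_add v Ev\<close>)
    qed
    ultimately have "(e \<longlongrightarrow> 0 - (\<Sum>a\<in>(Basis::'a set). \<Sum>b\<in>(Basis::'a set). 0)) (at_right 0)"
      unfolding e_def[abs_def] by (intro tendsto_diff tendsto_sum)
    then show ?thesis by simp
  qed
  have main: "(\<integral>\<^sup>+x. ennreal (cut_weight \<epsilon> (norm x) * (k (norm x) * (u x * u x))) \<partial>lborel) \<le> L + ennreal \<bar>e \<epsilon>\<bar>"
    and meas: "(\<lambda>x. ennreal (cut_weight \<epsilon> (norm x) * (k (norm x) * (u x * u x)))) \<in> borel_measurable lborel"
    if \<epsilon>: "0 < \<epsilon>" for \<epsilon>
  proof -
    have rc: "radial_cutoff R \<epsilon> S" using S \<epsilon> by unfold_locales auto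
    interpret radial_cutoff R \<epsilon> S by (rule rc)
    have lap: "supported (laplacian u)"
      unfolding supported_def
    proof
      show "smooth (laplacian u)"
        unfolding laplacian_def[abs_def] by (intro smooth_sum smooth_partial_deriv u)
      show "\<forall>x. x \<notin> S \<longrightarrow> laplacian u x = 0"
        using laplacian_eq_0[OF u(1) compact_imp_closed[OF S(1)] u(2)] by blast
    qed
    let ?J = "\<integral>x. cut_weight \<epsilon> (norm x) * ((norm x)\<^sup>2 * laplacian u x)\<^sup>2 \<partial>lborel"
    have I: "integrable lborel (\<lambda>x. cut_weight \<epsilon> (norm x) * (k (norm x) * (u x * u x)))"
      by (rule integrable_cut_weight[OF kc supported_mult[OF uS uS]])
    then show "(\<lambda>x. ennreal (cut_weight \<epsilon> (norm x) * (k (norm x) * (u x * u x)))) \<in> borel_measurable lborel"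
      by (intro measurable_compose[OF borel_measurable_integrable measurable_ennreal])
    have J: "integrable lborel (\<lambda>x. cut_weight \<epsilon> (norm x) * ((norm x)\<^sup>2 * laplacian u x)\<^sup>2)"
    proof -
      have "integrable lborel (\<lambda>x. cut_weight \<epsilon> (norm x) * (norm x ^ 4 * (laplacian u x * laplacian u x)))"
        by (intro integrable_cut_weight[of "\<lambda>r. r ^ 4"] continuous_intros supported_mult lap)
      then show ?thesis by (simp add: power_mult_distrib power2_eq_square[of "laplacian u _"] flip: power_mult)
    qed
    have pos: "0 \<le> cut_weight \<epsilon> (norm x) * (k (norm x) * (u x * u x))" for x
    proof (cases "x = 0 \<or> R \<le> norm x")
      case True
      then have "cut_weight \<epsilon> (norm x) = 0 \<or> x \<notin> S"
        using \<epsilon> S_subset by (auto simp: cut_weight_eq_0)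
      then show ?thesis using u(2)[of x] by auto
    next
      case False
      then show ?thesis
        by (intro mult_nonneg_nonneg[OF cut_weight_nonneg] mult_nonneg_nonneg[OF k0 zero_le_square]) auto
    qed
    have "(\<integral>\<^sup>+x. ennreal (cut_weight \<epsilon> (norm x) * (k (norm x) * (u x * u x))) \<partial>lborel)
      = ennreal (\<integral>x. cut_weight \<epsilon> (norm x) * (k (norm x) * (u x * u x)) \<partial>lborel)"
      using I pos by (intro nn_integral_eq_integral) auto
    also have "\<dots> \<le> ennreal (?J + \<bar>e \<epsilon>\<bar>)"
      using hardy_rellich_cutoff[OF rc uS dim q(1-4) less_imp_le[OF c] W lam]
      unfolding k_def K_def M_def e_def v_def w_def n_def by (intro ennreal_leI) linarith
    also have "\<dots> = ennreal ?J + ennreal \<bar>e \<epsilon>\<bar>"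
      by (intro ennreal_plus integral_nonneg_AE always_eventually allI mult_nonneg_nonneg cut_weight_nonneg) auto
    also have "ennreal ?J = (\<integral>\<^sup>+x. ennreal (cut_weight \<epsilon> (norm x) * ((norm x)\<^sup>2 * laplacian u x)\<^sup>2) \<partial>lborel)"
      using J by (intro nn_integral_eq_integral[symmetric] always_eventually allI mult_nonneg_nonneg cut_weight_nonneg) auto
    also have "\<dots> \<le> L"
      unfolding L_def
    proof (rule nn_integral_mono)
      fix x :: 'a
      show "ennreal (cut_weight \<epsilon> (norm x) * ((norm x)\<^sup>2 * laplacian u x)\<^sup>2)
        \<le> ennreal ((laplacian u x)\<^sup>2) * indicator (ball 0 R) x"
      proof (cases "x \<in> ball 0 R")
        case True
        \<comment> \<open>The fourth power of \<open>norm x\<close> from the square cancels the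
          singular weight and leaves the cutoff step, which is at most 1.\<close>
        have "cut_weight \<epsilon> (norm x) * ((norm x)\<^sup>2 * laplacian u x)\<^sup>2 \<le> 1 * (laplacian u x)\<^sup>2"
        proof (cases "x = 0")
          case False
          then have "cut_weight \<epsilon> (norm x) * ((norm x)\<^sup>2 * laplacian u x)\<^sup>2 = cutoff_step (norm x / \<epsilon>) * (laplacian u x)\<^sup>2"
            by (simp add: cut_weight_def power_mult_distrib flip: power_mult)
          also have "\<dots> \<le> 1 * (laplacian u x)\<^sup>2"
            by (intro mult_right_mono cutoff_step_bounds) simp
          finally show ?thesis .
        qed simp
        then show ?thesis using True by (simp add: ennreal_leI)
      next
        case False
        then have "laplacian u x = 0" using S(2) by (intro supported_eq_0[OF lap]) auto
        then show ?thesis by simp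
      qed
    qed
    finally show "(\<integral>\<^sup>+x. ennreal (cut_weight \<epsilon> (norm x) * (k (norm x) * (u x * u x))) \<partial>lborel) \<le> L + ennreal \<bar>e \<epsilon>\<bar>"
      by (simp add: add_right_mono)
  qed
  define \<epsilon> where "\<epsilon> i = 1 / real (Suc i)" for i
  have \<epsilon>: "0 < \<epsilon> i" for i by (simp add: \<epsilon>_def)
  have \<epsilon>0: "\<epsilon> \<longlonglongrightarrow> 0" unfolding \<epsilon>_def by (rule lim_1_over_n[THEN LIMSEQ_Suc])
  let ?f = "\<lambda>i x. ennreal (cut_weight (\<epsilon> i) (norm x) * (k (norm x) * (u x * u x)))"
  \<comment> \<open>Pointwise the sequence is eventually constant: once
    \<open>2 * \<epsilon> i \<le> norm x\<close> the cutoff equals 1.\<close>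
  have lim: "(\<lambda>i. ?f i x) \<longlonglongrightarrow> ennreal (F x) * indicator (ball 0 R) x" for x
  proof (cases "x \<in> ball 0 R \<and> x \<noteq> 0")
    case True
    then have "eventually (\<lambda>i. \<epsilon> i < norm x / 2) sequentially"
      by (intro order_tendstoD(2)[OF \<epsilon>0]) simp
    then have "eventually (\<lambda>i. ennreal (F x) * indicator (ball 0 R) x = ?f i x) sequentially"
    proof (rule eventually_mono)
      fix i assume "\<epsilon> i < norm x / 2"
      then have "2 \<le> norm x / \<epsilon> i" using \<epsilon>[of i] by (simp add: field_simps)
      then show "ennreal (F x) * indicator (ball 0 R) x = ?f i x"
        using True by (simp add: cut_weight_def cutoff_step_ge_2 F_def)
    qed
    then show ?thesis by (rule Lim_transform_eventually[OF tendsto_const])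
  next
    case False
    then have "x = 0 \<or> x \<notin> S" using S(2) by auto
    then have "?f i x = 0" for i
      using u(2)[of x] \<epsilon>[of i] by (auto simp: cut_weight_eq_0)
    \<comment> \<open>At the origin \<open>F\<close> is 0 because division by zero yields 0, in
      agreement with the vanishing weight.\<close>
    moreover have "ennreal (F x) * indicator (ball 0 R) x = 0"
      using False by (auto simp: F_def)
    ultimately show ?thesis by (simp only: tendsto_const)
  qed
  \<comment> \<open>Fatou's lemma along \<open>\<epsilon> i\<close>.\<close>
  have "(\<integral>\<^sup>+x\<in>ball 0 R. ennreal (F x) \<partial>lborel) = (\<integral>\<^sup>+x. liminf (\<lambda>i. ?f i x) \<partial>lborel)"
    by (intro nn_integral_cong lim_imp_Liminf[symmetric] lim) simp
  also have "\<dots> \<le> liminf (\<lambda>i. \<integral>\<^sup>+x. ?f i x \<partial>lborel)"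
    by (intro nn_integral_liminf meas \<epsilon>)
  also have "\<dots> \<le> liminf (\<lambda>i. L + ennreal \<bar>e (\<epsilon> i)\<bar>)"
    by (intro Liminf_mono always_eventually allI main \<epsilon>)
  also have "\<dots> = L"
  proof (rule lim_imp_Liminf)
    have "filterlim \<epsilon> (at_right 0) sequentially"
      using \<epsilon>0 \<epsilon> by (auto simp: filterlim_at less_imp_neq[symmetric])
    then have "(\<lambda>i. e (\<epsilon> i)) \<longlonglongrightarrow> 0" by (rule filterlim_compose[OF e0])
    then have "(\<lambda>i. \<bar>e (\<epsilon> i)\<bar>) \<longlonglongrightarrow> 0" by (rule tendsto_rabs_zero)
    then have "(\<lambda>i. L + ennreal \<bar>e (\<epsilon> i)\<bar>) \<longlonglongrightarrow> L + ennreal 0"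
      by (intro tendsto_add tendsto_const tendsto_ennrealI)
    then show "(\<lambda>i. L + ennreal \<bar>e (\<epsilon> i)\<bar>) \<longlonglongrightarrow> L" by simp
  qed simp
  finally have "(\<integral>\<^sup>+x\<in>ball 0 R. ennreal (F x) \<partial>lborel) \<le> L" .
  moreover have "F x = n\<^sup>2 * (n - 4)\<^sup>2 / 16 * ((u x)\<^sup>2 / norm x ^ 4)
        + (n\<^sup>2 / 4 + (n - lam - 2)\<^sup>2 / 4) * c * (W (norm x) / (norm x)\<^sup>2 * (u x)\<^sup>2)" for x
  proof (cases "x = 0")
    case False
    then show ?thesis
      unfolding F_def k_def K_def[symmetric] M_def[symmetric]
      by (simp add: field_simps power2_eq_square eval_nat_numeral)
  qed (simp add: F_def)
  ultimately show ?thesis unfolding L_def by simp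
qed

section \<open>Passage to the supremum over admissible constants\<close>

theorem theorem3p6:
  fixes R lam n :: real
    and W f :: "real \<Rightarrow> real"
    and u :: "real ^ 'n \<Rightarrow> real"
  defines "n \<equiv> real CARD('n)"
  assumes "CARD('n) \<ge> 4"
    and "0 < R"
    and "bessel_potential W R"
    and "\<And>r. r \<in> {0<..<R} \<Longrightarrow> W r \<noteq> 0"
    and "\<And>r. r \<in> {0<..<R} \<Longrightarrow> deriv W r / W r = - lam / r + f r"
    and "\<And>r. r \<in> {0<..<R} \<Longrightarrow> 0 \<le> f r"
    and "((\<lambda>r. r * f r) \<longlongrightarrow> 0) (at_right 0)"
    and "lam < n - 2"
    and "u \<in> test_functions (ball 0 R)"
  shows "(\<integral>\<^sup>+x\<in>ball 0 R. ennreal ((laplacian u x)\<^sup>2) \<partial>lborel) \<ge>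
           ennreal (n\<^sup>2 * (n - 4)\<^sup>2 / 16) *
             (\<integral>\<^sup>+x\<in>ball 0 R. ennreal ((u x)\<^sup>2 / norm x ^ 4) \<partial>lborel)
         + ennreal (n\<^sup>2 / 4 + (n - lam - 2)\<^sup>2 / 4) * bessel_weight W R *
             (\<integral>\<^sup>+x\<in>ball 0 R. ennreal (W (norm x) / (norm x)\<^sup>2 * (u x)\<^sup>2) \<partial>lborel)"
proof -
  have W_nonneg: "\<And>r. r \<in> {0<..<R} \<Longrightarrow> 0 \<le> W r" and W_C1: "W C1_differentiable_on {0<..<R}"
    and adm: "admissible_constants W R \<noteq> {}"
    using assms(4) by (auto simp: bessel_potential_def)
  obtain W' where W': "\<And>r. r \<in> {0<..<R} \<Longrightarrow> (W has_real_derivative W' r) (at r)"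
    and W'c: "continuous_on {0<..<R} W'"
    using W_C1 unfolding C1_differentiable_on_def has_real_derivative_iff_has_vector_derivative by blast
  have Wc: "continuous_on {0<..<R} W"
    by (rule continuous_at_imp_continuous_on) (auto intro: DERIV_isCont W')
  \<comment> \<open>Multiplying the logarithmic derivative by \<open>r * W r\<close>, which is
    positive, turns \<open>0 \<le> f r\<close> into the growth condition of the weighted Hardy
    inequality.\<close>
  have W'_ge: "- lam * W r \<le> r * W' r" if r: "r \<in> {0<..<R}" for r
  proof -
    have W0: "0 < W r" using W_nonneg[OF r] assms(5)[OF r] by simp
    have "W' r / W r = - lam / r + f r" using assms(6)[OF r] DERIV_imp_deriv[OF W'[OF r]] by simp
    then have "r * W' r = - lam * W r + r * (W r * f r)"
      using W0 r by (simp add: field_simps)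
    then show ?thesis using W0 r assms(7)[OF r] by simp
  qed
  define S where "S = closure {x. u x \<noteq> 0}"
  have S: "compact S" "S \<subseteq> ball 0 R" "smooth u" "\<And>x. x \<notin> S \<Longrightarrow> u x = 0"
    using assms(10) closure_subset[of "{x. u x \<noteq> 0}"] by (auto simp: test_functions_def S_def smooth_def)
  have uc: "continuous_on T u" for T by (rule smooth_continuous[OF S(3)])
  define g1 where "g1 x = ennreal ((u x)\<^sup>2 / norm x ^ 4) * indicator (ball 0 R) x" for x
  define g2 where "g2 x = ennreal (W (norm x) / (norm x)\<^sup>2 * (u x)\<^sup>2) * indicator (ball 0 R) x" for x
  have g1: "g1 \<in> borel_measurable lborel"
  proof -
    have [measurable]: "u \<in> borel_measurable borel" by (rule borel_measurable_continuous_onI[OF uc])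
    have "(\<lambda>x. ennreal ((u x)\<^sup>2 / norm x ^ 4)) \<in> borel_measurable lborel" by measurable
    then show ?thesis
      unfolding g1_def by (intro borel_measurable_times_ennreal borel_measurable_indicator) auto
  qed
  have g2: "g2 \<in> borel_measurable lborel"
  proof -
    \<comment> \<open>Continuity of \<open>W\<close> is known on \<open>{0<..<R}\<close> only, so
      measurability is shown on the punctured ball. Removing the origin changes nothing, since the
      quotient by \<open>(norm x)\<^sup>2\<close> is 0 there.\<close>
    have "(\<lambda>x. indicator (ball 0 R - {0}) x *\<^sub>R (W (norm x) / (norm x)\<^sup>2 * (u x)\<^sup>2)) \<in> borel_measurable borel"
      by (rule borel_measurable_continuous_on_indicator)
        (auto intro!: continuous_intros continuous_on_compose2[OF Wc] uc)
    then have "(\<lambda>x. ennreal (indicator (ball 0 R - {0}) x *\<^sub>R (W (norm x) / (norm x)\<^sup>2 * (u x)\<^sup>2))) \<in> borel_measurable lborel"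
      by simp
    moreover have "(\<lambda>x. ennreal (indicator (ball 0 R - {0}) x *\<^sub>R (W (norm x) / (norm x)\<^sup>2 * (u x)\<^sup>2))) = g2"
      by (auto simp: g2_def fun_eq_iff split: split_indicator)
    ultimately show ?thesis by simp
  qed
  define K where "K = n\<^sup>2 * (n - 4)\<^sup>2 / 16"
  define M where "M = n\<^sup>2 / 4 + (n - lam - 2)\<^sup>2 / 4"
  have KM: "0 \<le> K" "0 \<le> M" by (simp_all add: K_def M_def)
  let ?L = "\<integral>\<^sup>+x\<in>ball 0 R. ennreal ((laplacian u x)\<^sup>2) \<partial>lborel"
  have le: "ennreal K * integral\<^sup>N lborel g1 + ennreal M * ennreal c * integral\<^sup>N lborel g2 \<le> ?L"
    if "c \<in> admissible_constants W R" for c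
  proof -
    from that obtain y where c: "0 < c" and y: "positive_solution W R c y"
      by (auto simp: admissible_constants_def)
    have "ennreal K * integral\<^sup>N lborel g1 + ennreal M * ennreal c * integral\<^sup>N lborel g2
      = (\<integral>\<^sup>+x. ennreal K * g1 x + ennreal M * ennreal c * g2 x \<partial>lborel)"
      using g1 g2 by (simp add: nn_integral_add nn_integral_cmult)
    also have "\<dots> = (\<integral>\<^sup>+x\<in>ball 0 R. ennreal (K * ((u x)\<^sup>2 / norm x ^ 4)
        + M * c * (W (norm x) / (norm x)\<^sup>2 * (u x)\<^sup>2)) \<partial>lborel)"
    proof (intro nn_integral_cong)
      fix x :: "real ^ 'n"
      show "ennreal K * g1 x + ennreal M * ennreal c * g2 x =
        ennreal (K * ((u x)\<^sup>2 / norm x ^ 4) + M * c * (W (norm x) / (norm x)\<^sup>2 * (u x)\<^sup>2)) * indicator (ball 0 R) x"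
      proof (cases "x \<in> ball 0 R")
        case True
        let ?A = "(u x)\<^sup>2 / norm x ^ 4" and ?B = "W (norm x) / (norm x)\<^sup>2 * (u x)\<^sup>2"
        have B: "0 \<le> ?B"
          using True W_nonneg[of "norm x"] by (cases "x = 0") auto
        have "0 \<le> M * c * ?B"
          by (rule mult_nonneg_nonneg[OF _ B]) (use KM c in auto)
        moreover have "0 \<le> K * ?A" using KM by simp
        ultimately have "ennreal (K * ?A + M * c * ?B) = ennreal (K * ?A) + ennreal (M * c * ?B)"
          by (intro ennreal_plus)
        also have "\<dots> = ennreal K * ennreal ?A + ennreal M * ennreal c * ennreal ?B"
          using KM c by (simp only: ennreal_mult' mult_nonneg_nonneg less_imp_le)
        finally show ?thesis
          using True by (simp add: g1_def g2_def)
      qed (simp add: g1_def g2_def)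
    qed
    also have "\<dots> \<le> ?L"
      unfolding K_def M_def n_def
      using hardy_rellich_admissible[OF assms(3) S(1,2) S(3,4) _ y c W' W'c W_nonneg W'_ge] assms(2,9)
      by (simp add: n_def)
    finally show ?thesis .
  qed
  \<comment> \<open>Multiplication commutes with suprema in the extended nonnegative reals, and so
    does adding a constant when the index set is nonempty, which \<open>adm\<close> provides. An
    infinite weight is covered as well.\<close>
  have "ennreal K * integral\<^sup>N lborel g1 + ennreal M * bessel_weight W R * integral\<^sup>N lborel g2
    = (SUP c\<in>admissible_constants W R. ennreal K * integral\<^sup>N lborel g1 + ennreal M * ennreal c * integral\<^sup>N lborel g2)"
    unfolding bessel_weight_def SUP_mult_left_ennreal SUP_mult_right_ennreal
    by (rule ennreal_SUP_add_right[OF adm])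
  also have "\<dots> \<le> ?L" by (rule SUP_least) (rule le)
  finally show ?thesis unfolding g1_def g2_def K_def M_def .
qed

end
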